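(* Let $E\subset\mathbb{R}^2$ be a closed set which is weakly $1$-semiconvex and is not $1$-semiconvex. Then $E$ consists of at least three components.
   Context: In the plane, a $1$-dimensional half-plane is a ray (closed half-line). A set $E\subset\mathbb{R}^2$ is called $1$-semiconvex with respect to a point $x\in\mathbb{R}^2\setminus E$ if there exists a ray $L$ such that $x\in L$ and $L\cap E=\emptyset$ (equivalently, there is a ray starting at $x$ that does not meet $E$). A set $E\subset\mathbb{R}^2$ is called $1$-semiconvex if it is $1$-semiconvex with respect to every point $x\in\mathbb{R}^2\setminus E$. An open set $G\subset\mathbb{R}^2$ is called weakly $1$-semiconvex if it is $1$-semiconvex with respect to every point $x\in\partial G$, where $\partial G=\overline{G}\setminus\mathrm{Int}\,G$. A set $A$ is approximated from the outside by a family of open sets $A_k$, $k=1,2,\ldots$, if $\overline{A}_{k+1}\subset A_k$ for all $k$ and $A=\bigcap_k A_k$. A closed set $E\subset\mathbb{R}^2$ is called weakly $1$-semiconvex if it can be approximated from the outside by a family of open weakly $1$-semiconvex sets. The components of a nonempty set are its maximal connected subsets. *)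

theory Defs
  imports "HOL-Analysis.Analysis"
begin

definition is_ray :: "(real^2) set \<Rightarrow> bool" where
  "is_ray L \<longleftrightarrow> (\<exists>a d. d \<noteq> 0 \<and> L = {a + t *\<^sub>R d | t. t \<ge> 0})"

(* The ray only has to contain x, not to start there; x \<notin> E is implied. *)
definition semiconvex1_wrt :: "(real^2) set \<Rightarrow> real^2 \<Rightarrow> bool" where
  "semiconvex1_wrt E x \<longleftrightarrow> (\<exists>L. is_ray L \<and> x \<in> L \<and> L \<inter> E = {})"

definition semiconvex1 :: "(real^2) set \<Rightarrow> bool" where
  "semiconvex1 E \<longleftrightarrow> (\<forall>x. x \<notin> E \<longrightarrow> semiconvex1_wrt E x)"

definition weakly_semiconvex1_open :: "(real^2) set \<Rightarrow> bool" where
  "weakly_semiconvex1_open G \<longleftrightarrow> open G \<and> (\<forall>x \<in> frontier G. semiconvex1_wrt G x)"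

(* The family is indexed from 0 instead of 1. *)
definition approximated_from_outside :: "(real^2) set \<Rightarrow> (nat \<Rightarrow> (real^2) set) \<Rightarrow> bool" where
  "approximated_from_outside E A \<longleftrightarrow>
     (\<forall>k. open (A k)) \<and> (\<forall>k. closure (A (Suc k)) \<subseteq> A k) \<and> E = (\<Inter>k. A k)"

(* Weak 1-semiconvexity of open and of closed sets are two separate notions,
   hence two predicates. *)
definition weakly_semiconvex1_closed :: "(real^2) set \<Rightarrow> bool" where
  "weakly_semiconvex1_closed E \<longleftrightarrow>
     closed E \<and> (\<exists>A. approximated_from_outside E A \<and> (\<forall>k. weakly_semiconvex1_open (A k)))"

end

theory Submission
  imports Defs
begin

text \<open>
Let \<open>E\<close> have at most two components and let \<open>x\<close> be a point outside \<open>E\<close> that cannot escape, that is, all rays from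
\<open>x\<close> hit \<open>E\<close>.  A member \<open>U\<close> of the approximating family misses \<open>x\<close>.  It contains \<open>E\<close>, and from every point of
its frontier one can escape.  By compactness of the circle of directions, two bounded connected open
sets \<open>G1\<close>, \<open>G2\<close> with closures in \<open>U\<close> already block all rays from \<open>x\<close> (\<open>blocking_neighbourhoods\<close>).  Let \<open>Z\<close> be the
set of all points exterior to \<open>U\<close> that are trapped by \<open>G1 \<union> G2\<close>.  It is nonempty, open and bounded, and its closure
does not touch the frontier of \<open>U\<close>, from which one can escape.  The rest of the proof shows that there is no
such set \<open>Z\<close>, by looking at extreme points of its convex hull.

The tool is \<open>sweep\<close>: if two free rays start on the same side of a free segment, at its two ends, and neither
obstacle is enclosed by them, then every point of the segment has a free ray.  It has two consequences.

First, it describes \<open>Z\<close> near a point \<open>p\<close> of its frontier.  The points near \<open>p\<close> that escape roughly in a given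
free direction \<open>d\<close> of \<open>p\<close> form a convex set, which lies on one side of the line through \<open>p\<close> along \<open>d\<close>
(\<open>local_half_plane\<close>).  As there are only two obstacles, at most two directions are free at \<open>p\<close>
(\<open>at_most_two_free_directions\<close>).  Hence \<open>Z\<close> contains, near \<open>p\<close>, the intersection of at most two open half-planes.
At an extreme point \<open>p\<close> there are exactly two free directions \<open>d\<close> and \<open>e\<close> (\<open>extreme_point_corner\<close>), and they
separate \<open>G1\<close> from \<open>G2\<close>: one obstacle blocks the convex sector between \<open>d\<close> and \<open>e\<close>, the other one blocks the
complement.

Second, \<open>Z\<close> does not face the obstacle in the convex sector (\<open>not_trapped_in_sector\<close>): a walk from \<open>p\<close> inside
\<open>Z\<close> towards that obstacle would leave \<open>Z\<close> at a point with a free ray, and sweeping this ray back to \<open>d\<close> or \<open>e\<close>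
would free the points of the walk.

If some point of \<open>Z\<close> were outside the closed convex hull of \<open>G1\<close>, a linear functional would separate it from \<open>G1\<close>.
At an extreme point minimising that functional, \<open>G1\<close> is the obstacle in the convex sector, and the
trapped points nearby either contradict minimality or face \<open>G1\<close>.  So \<open>Z\<close> lies in the closed convex hulls of
both obstacles (\<open>Z_subset_hull\<close>).  But an extreme point of the hull of \<open>Z\<close> is outside the closed hull of an
obstacle in a convex sector at that point; and if the two free directions are opposite, the two hulls have at most
points of a line in common, while \<open>Z\<close> is open.

The planar arguments take place in the complex plane, where \<open>det2 a b\<close> is positive if \<open>b\<close> points to the left
of \<open>a\<close>.
\<close>

section \<open>Orientation and free rays\<close>

definition det2 :: "complex \<Rightarrow> complex \<Rightarrow> real" where
  "det2 a b = Re a * Im b - Im a * Re b"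

definition avoids :: "complex set \<Rightarrow> complex \<Rightarrow> complex \<Rightarrow> bool" where
  "avoids G p v \<longleftrightarrow> (\<forall>t\<ge>0. p + t *\<^sub>R v \<notin> G)"

lemma det2_simps [simp]:
  "det2 a a = 0" "det2 0 a = 0" "det2 a 0 = 0"
  "det2 (a + b) c = det2 a c + det2 b c" "det2 c (a + b) = det2 c a + det2 c b"
  "det2 (- a) c = - det2 a c" "det2 c (- a) = - det2 c a"
  "det2 (t *\<^sub>R a) c = t * det2 a c" "det2 c (t *\<^sub>R a) = t * det2 c a"
  by (auto simp: det2_def algebra_simps)

lemma det2_diff:
  "det2 (a - b) c = det2 a c - det2 b c" "det2 c (a - b) = det2 c a - det2 c b"
  by (auto simp: det2_def algebra_simps)

lemma det2_commute: "det2 a b = - det2 b a"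
  by (auto simp: det2_def)

lemma continuous_on_det2 [continuous_intros]:
  "continuous_on S f \<Longrightarrow> continuous_on S g \<Longrightarrow> continuous_on S (\<lambda>x. det2 (f x) (g x))"
  unfolding det2_def by (intro continuous_intros)

lemma det2_cramer: "det2 d e *\<^sub>R y = det2 y e *\<^sub>R d + det2 d y *\<^sub>R e"
  by (auto simp: det2_def complex_eq_iff algebra_simps)

lemma det2_basis:
  assumes "det2 d e \<noteq> 0"
  shows "y = (det2 y e / det2 d e) *\<^sub>R d + (det2 d y / det2 d e) *\<^sub>R e"
proof -
  have "y = (1 / det2 d e) *\<^sub>R (det2 d e *\<^sub>R y)" using assms by simp
  also have "\<dots> = (1 / det2 d e) *\<^sub>R (det2 y e *\<^sub>R d + det2 d y *\<^sub>R e)"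
    by (subst det2_cramer) (rule refl)
  also have "\<dots> = (det2 y e / det2 d e) *\<^sub>R d + (det2 d y / det2 d e) *\<^sub>R e"
    by (simp add: scaleR_add_right)
  finally show ?thesis .
qed

lemma det2_eq_0:
  assumes "det2 d y = 0" "d \<noteq> 0"
  shows "y = ((d \<bullet> y) / (d \<bullet> d)) *\<^sub>R d"
proof -
  have dd: "d \<bullet> d \<noteq> 0" using assms by simp
  have "(d \<bullet> d) *\<^sub>R y = (d \<bullet> y) *\<^sub>R d"
    using assms(1) by (auto simp: complex_eq_iff inner_complex_def det2_def) (algebra)+
  then have "(1 / (d \<bullet> d)) *\<^sub>R ((d \<bullet> d) *\<^sub>R y) = (1 / (d \<bullet> d)) *\<^sub>R ((d \<bullet> y) *\<^sub>R d)" by simp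
  then show ?thesis using dd by simp
qed

lemma avoids_scale:
  assumes "avoids G p v" "c \<ge> 0" shows "avoids G p (c *\<^sub>R v)"
  using assms unfolding avoids_def by (metis scaleR_scaleR mult_nonneg_nonneg)

lemma avoids_advance:
  assumes "avoids G p v" "s \<ge> 0" shows "avoids G (p + s *\<^sub>R v) v"
  using assms unfolding avoids_def
  by (metis add.assoc add_nonneg_nonneg scaleR_left_distrib)

lemma avoids_Un: "avoids (A \<union> B) p v \<longleftrightarrow> avoids A p v \<and> avoids B p v"
  by (auto simp: avoids_def)

lemma avoidsD: "avoids G p v \<Longrightarrow> t \<ge> 0 \<Longrightarrow> p + t *\<^sub>R v \<notin> G"
  by (auto simp: avoids_def)

text \<open>The way connectedness enters all planar separation arguments below: a connected set that meets a closed
region only in its interior part is either inside or outside.  It replaces any appeal to the Jordan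
curve theorem, because the regions that occur are cut out by a few inequalities.\<close>
lemma connected_subset_or_disjoint:
  assumes "connected S" "closed A" "open B" "B \<subseteq> A" "S \<inter> A \<subseteq> B"
  shows "S \<subseteq> B \<or> S \<inter> A = {}"
proof -
  have "B \<inter> - A \<inter> S = {}" "S \<subseteq> B \<union> - A" using assms by auto
  then have "B \<inter> S = {} \<or> - A \<inter> S = {}"
    using connectedD[OF assms(1,3), of "- A"] assms(2) by auto
  then show ?thesis using assms by blast
qed

section \<open>Sweeping one free ray into another\<close>

text \<open>Two free rays on the same side of the segment from \<open>p\<close> to \<open>q\<close> bound, together with that segment, a region
\<open>A\<close>: the part of the half-plane between the rays if they do not cross, and a triangle together with the opposite wedge at the crossing
point if they cross.  Both shapes are given by one formula, namely that the two orientations with respect to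
the lines of the rays have opposite signs.  The boundary of \<open>A\<close> consists of the rays and the segment, so
a connected set that avoids these and has a point outside \<open>A\<close> avoids \<open>A\<close>.  Normalising the two directions
to have the same height over the segment makes the interpolated rays stay in \<open>A\<close>; in the crossing case
all of them pass through the crossing point.\<close>
lemma sweep:
  assumes S: "connected S"
    and D: "det2 (q - p) v > 0" and V: "det2 (q - p) w > 0"
    and av: "avoids S p v" "avoids S q w" and seg: "closed_segment p q \<inter> S = {}"
    and g: "g \<in> S" "det2 (q - p) (g - p) < 0 \<or> det2 v (g - p) * det2 w (g - q) > 0"
    and s: "0 \<le> s" "s \<le> 1"
  shows "avoids S (p + s *\<^sub>R (q - p))
           (((1 - s) / det2 (q - p) v) *\<^sub>R v + (s / det2 (q - p) w) *\<^sub>R w)"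
proof -
  define u where "u = q - p"
  define A where "A = {y. det2 u (y - p) \<ge> 0 \<and> det2 v (y - p) * det2 w (y - q) \<le> 0}"
  define B where "B = {y. det2 u (y - p) > 0 \<and> det2 v (y - p) * det2 w (y - q) < 0}"
  have Du: "det2 u v > 0" "det2 u w > 0" using D V by (auto simp: u_def)
  then have nz: "u \<noteq> 0" "v \<noteq> 0" "w \<noteq> 0" by auto
  have "closed A" unfolding A_def
    by (intro closed_Collect_conj closed_Collect_le continuous_intros)
  moreover have "open B" unfolding B_def
    by (intro open_Collect_conj open_Collect_less continuous_intros)
  moreover have "B \<subseteq> A" by (auto simp: A_def B_def)
  moreover have "S \<inter> A \<subseteq> B"
  proof
    fix y assume y: "y \<in> S \<inter> A"
    have 1: "det2 u (y - p) \<noteq> 0"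
    proof
      assume 0: "det2 u (y - p) = 0"
      define l where "l = (u \<bullet> (y - p)) / (u \<bullet> u)"
      have yl: "y - p = l *\<^sub>R u" using det2_eq_0[OF 0 nz(1)] by (simp add: l_def)
      have yq: "y - q = (l - 1) *\<^sub>R u" using yl by (auto simp: u_def algebra_simps)
      have "det2 v (y - p) * det2 w (y - q) \<le> 0" using y by (simp only: A_def Int_iff mem_Collect_eq)
      then have "l * (l - 1) * (det2 u v * det2 u w) \<le> 0"
        unfolding yl yq by (simp add: det2_commute[of v u] det2_commute[of w u] mult_ac)
      then have "l * (l - 1) \<le> 0" using Du by (simp add: mult_le_0_iff)
      then have "0 \<le> l" "l \<le> 1" by (auto simp: mult_le_0_iff)
      then have "y \<in> closed_segment p q" using yl
        by (auto simp: closed_segment_def u_def algebra_simps intro!: exI[of _ l])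
      then show False using seg y by auto
    qed
    have 2: "det2 v (y - p) \<noteq> 0"
    proof
      assume 0: "det2 v (y - p) = 0"
      define l where "l = (v \<bullet> (y - p)) / (v \<bullet> v)"
      have yl: "y - p = l *\<^sub>R v" using det2_eq_0[OF 0 nz(2)] by (simp add: l_def)
      have "l * det2 u v \<ge> 0" using y unfolding A_def Int_iff mem_Collect_eq yl by simp
      then have "l \<ge> 0" using Du by (simp add: zero_le_mult_iff)
      then have "p + l *\<^sub>R v \<notin> S" using av(1) by (simp add: avoids_def)
      then show False using y yl by (metis IntD1 add.commute diff_add_cancel)
    qed
    have 3: "det2 w (y - q) \<noteq> 0"
    proof
      assume 0: "det2 w (y - q) = 0"
      define l where "l = (w \<bullet> (y - q)) / (w \<bullet> w)"
      have yl: "y - q = l *\<^sub>R w" using det2_eq_0[OF 0 nz(3)] by (simp add: l_def)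
      have yp: "y - p = u + l *\<^sub>R w" using yl by (auto simp: u_def algebra_simps)
      have "l * det2 u w \<ge> 0" using y unfolding A_def Int_iff mem_Collect_eq yp by simp
      then have "l \<ge> 0" using Du by (simp add: zero_le_mult_iff)
      then have "q + l *\<^sub>R w \<notin> S" using av(2) by (simp add: avoids_def)
      then show False using y yl by (metis IntD1 add.commute diff_add_cancel)
    qed
    have "det2 v (y - p) * det2 w (y - q) \<noteq> 0" using 2 3 by simp
    then show "y \<in> B" using 1 y unfolding A_def B_def Int_iff mem_Collect_eq by linarith
  qed
  ultimately have "S \<subseteq> B \<or> S \<inter> A = {}" by (rule connected_subset_or_disjoint[OF S])
  moreover have "g \<notin> B" using g(2) by (auto simp: B_def u_def)
  ultimately have dis: "S \<inter> A = {}" using g(1) by auto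
  define X where "X = det2 v w / (det2 u v * det2 u w)"
  define d where "d = ((1 - s) / det2 u v) *\<^sub>R v + (s / det2 u w) *\<^sub>R w"
  have "p + s *\<^sub>R u + t *\<^sub>R d \<in> A" if t: "t \<ge> 0" for t
  proof -
    have ud: "det2 u d = 1" using Du by (simp add: d_def)
    have vd: "det2 v d = s * (det2 u v * X)" using Du by (simp add: d_def X_def)
    have wd: "det2 w d = - (1 - s) * (det2 u w * X)"
      using Du by (simp add: d_def X_def det2_commute[of w v] field_simps)
    have eq: "p + s *\<^sub>R u + t *\<^sub>R d - q = (s - 1) *\<^sub>R u + t *\<^sub>R d"
      by (simp add: u_def algebra_simps)
    have a: "det2 v (p + s *\<^sub>R u + t *\<^sub>R d - p) = - s * det2 u v * (1 - t * X)"
      using vd by (simp add: det2_commute[of v u] algebra_simps)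
    have b: "det2 w (p + s *\<^sub>R u + t *\<^sub>R d - q) = (1 - s) * det2 u w * (1 - t * X)"
    proof -
      have "det2 w (p + s *\<^sub>R u + t *\<^sub>R d - q) = (1 - s) * det2 u w + t * det2 w d"
        unfolding eq by (simp add: det2_commute[of w u] left_diff_distrib)
      then show ?thesis unfolding wd by (simp add: algebra_simps)
    qed
    \<comment> \<open>Up to nonnegative factors the product is minus a square, whether or not the rays cross.\<close>
    have "det2 v (p + s *\<^sub>R u + t *\<^sub>R d - p) * det2 w (p + s *\<^sub>R u + t *\<^sub>R d - q)
        = - (s * (1 - s) * (det2 u v * det2 u w) * (1 - t * X)\<^sup>2)"
      unfolding a b by (simp add: power2_eq_square)
    moreover have "s * (1 - s) * (det2 u v * det2 u w) * (1 - t * X)\<^sup>2 \<ge> 0"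
      using s Du by (intro mult_nonneg_nonneg) auto
    ultimately show ?thesis using ud t by (simp add: A_def)
  qed
  then show ?thesis using dis unfolding avoids_def d_def u_def by blast
qed

text \<open>Two free rays from one point cut the plane into a convex sector and its complement, and a connected set
that misses the rays lies in one of these two parts.\<close>
lemma sector:
  assumes S: "connected S" and X: "det2 d e \<noteq> 0" and av: "avoids S p d" "avoids S p e"
  shows "(\<forall>y\<in>S. \<exists>a>0. \<exists>b>0. y = p + a *\<^sub>R d + b *\<^sub>R e) \<or>
         (\<forall>a\<ge>0. \<forall>b\<ge>0. p + a *\<^sub>R d + b *\<^sub>R e \<notin> S)"
proof -
  define \<alpha> where "\<alpha> y = det2 (y - p) e / det2 d e" for y
  define \<beta> where "\<beta> y = det2 d (y - p) / det2 d e" for y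
  have rep: "y = p + \<alpha> y *\<^sub>R d + \<beta> y *\<^sub>R e" for y
    using det2_basis[OF X, of "y - p"] unfolding \<alpha>_def \<beta>_def by (simp add: algebra_simps)
  have rep': "\<alpha> (p + a *\<^sub>R d + b *\<^sub>R e) = a" "\<beta> (p + a *\<^sub>R d + b *\<^sub>R e) = b" for a b
    using X by (auto simp: \<alpha>_def \<beta>_def)
  define A where "A = {y. \<alpha> y \<ge> 0 \<and> \<beta> y \<ge> 0}"
  define B where "B = {y. \<alpha> y > 0 \<and> \<beta> y > 0}"
  have "closed A" unfolding A_def \<alpha>_def \<beta>_def
    by (intro closed_Collect_conj closed_Collect_le continuous_intros) (use X in auto)
  moreover have "open B" unfolding B_def \<alpha>_def \<beta>_def
    by (intro open_Collect_conj open_Collect_less continuous_intros) (use X in auto)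
  moreover have "B \<subseteq> A" by (auto simp: A_def B_def)
  moreover have "S \<inter> A \<subseteq> B"
  proof
    fix y assume y: "y \<in> S \<inter> A"
    have "\<alpha> y \<noteq> 0" using rep[of y] y avoidsD[OF av(2), of "\<beta> y"] by (auto simp: A_def)
    moreover have "\<beta> y \<noteq> 0" using rep[of y] y avoidsD[OF av(1), of "\<alpha> y"] by (auto simp: A_def)
    ultimately show "y \<in> B" using y by (auto simp: A_def B_def)
  qed
  ultimately have "S \<subseteq> B \<or> S \<inter> A = {}" by (rule connected_subset_or_disjoint[OF S])
  then show ?thesis
  proof
    assume "S \<subseteq> B"
    then show ?thesis using rep unfolding B_def by blast
  next
    assume "S \<inter> A = {}"
    moreover have "p + a *\<^sub>R d + b *\<^sub>R e \<in> A" if "a \<ge> 0" "b \<ge> 0" for a b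
      using that by (simp only: A_def mem_Collect_eq rep')
    ultimately show ?thesis by blast
  qed
qed

text \<open>The variant of the sector lemma that tolerates parallel rays; the auxiliary vector \<open>d\<close> only forces two
parallel directions to point the same way.\<close>
lemma fan:
  assumes S: "connected S" and av: "avoids S c v" "avoids S c w"
    and d: "v \<bullet> d > 0" "w \<bullet> d > 0"
    and g: "g \<in> S" "det2 v (g - c) * det2 w (g - c) > 0"
    and ab: "a \<ge> 0" "b \<ge> 0"
  shows "c + a *\<^sub>R v + b *\<^sub>R w \<notin> S"
proof (cases "det2 v w = 0")
  case True
  have "v \<noteq> 0" using d by auto
  then have w: "w = ((v \<bullet> w) / (v \<bullet> v)) *\<^sub>R v" using det2_eq_0[OF True] by simp
  define l where "l = (v \<bullet> w) / (v \<bullet> v)"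
  have "w \<bullet> d = l * (v \<bullet> d)" using w unfolding l_def by (metis inner_scaleR_left)
  then have "l > 0" using d by (metis zero_less_mult_pos2)
  then have "c + (a + b * l) *\<^sub>R v \<notin> S" using ab by (intro avoidsD[OF av(1)]) auto
  moreover have "w = l *\<^sub>R v" using w by (simp add: l_def)
  ultimately show ?thesis by (simp add: algebra_simps)
next
  case False
  have "\<not> (\<exists>a>0. \<exists>b>0. g = c + a *\<^sub>R v + b *\<^sub>R w)"
  proof clarify
    fix a b :: real assume ab: "a > 0" "b > 0" "g = c + a *\<^sub>R v + b *\<^sub>R w"
    have "det2 v (g - c) * det2 w (g - c) = - (a * b * (det2 v w)\<^sup>2)"
      unfolding ab(3) by (simp add: det2_commute[of w v] power2_eq_square)
    moreover have "a * b * (det2 v w)\<^sup>2 \<ge> 0" using ab by simp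
    ultimately show False using g(2) by linarith
  qed
  then show ?thesis using sector[OF S False av] g(1) ab by blast
qed

section \<open>Points that escape in nearby directions\<close>

lemma inner_det2_zero:
  assumes "a \<noteq> 0" "a \<bullet> d = 0" "det2 d e \<noteq> 0"
  shows "a \<bullet> e \<noteq> 0"
proof
  assume "a \<bullet> e = 0"
  have "a \<bullet> a = 0" 
    using arg_cong[OF det2_basis[OF assms(3), of a], of "\<lambda>x. a \<bullet> x"] assms(2) \<open>a \<bullet> e = 0\<close>
    by (simp add: inner_add_right)
  then show False using assms by simp
qed

text \<open>Near a point with free direction \<open>d\<close>, the points that have a free ray in roughly that direction form a
convex set.  Let \<open>q1\<close>, \<open>q2\<close> be two such points with rays \<open>v1\<close>, \<open>v2\<close>.  If both rays are on the same side of
the line through the points, one ray is swept into the other.  Otherwise the vector from one point to the other,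
or its opposite, lies in the cone spanned by the two directions; then the rays, extended backwards if necessary, meet near \<open>p\<close>, the cone spanned by them at the
meeting point is free, and every point of the segment runs into that cone.  The witnesses \<open>g1\<close>, \<open>g2\<close> each lie on
one side of the lines of all rays under consideration, so that neither obstacle can hide inside a swept region.\<close>
lemma convex_near:
  fixes d :: complex
  assumes G: "connected G1" "connected G2" and dis: "ball p (8 * r) \<inter> (G1 \<union> G2) = {}"
    and d: "norm d = 1" and \<eta>: "\<eta> \<le> 1/2"
    and w1: "g1 \<in> G1" "\<And>q q' v v'. q \<in> ball p r \<Longrightarrow> q' \<in> ball p r \<Longrightarrow> v \<in> ball d \<eta> \<Longrightarrow> v' \<in> ball d \<eta>
      \<Longrightarrow> det2 v (g1 - q) * det2 v' (g1 - q') > 0"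
    and w2: "g2 \<in> G2" "\<And>q q' v v'. q \<in> ball p r \<Longrightarrow> q' \<in> ball p r \<Longrightarrow> v \<in> ball d \<eta> \<Longrightarrow> v' \<in> ball d \<eta>
      \<Longrightarrow> det2 v (g2 - q) * det2 v' (g2 - q') > 0"
  shows "convex {q \<in> ball p r. \<exists>v\<in>ball d \<eta>. avoids (G1 \<union> G2) q v}" (is "convex ?F")
proof -
  have trans: "q1 + s *\<^sub>R (q2 - q1) \<in> ?F"
    if q: "q1 \<in> ball p r" "q2 \<in> ball p r" and v: "v1 \<in> ball d \<eta>" "v2 \<in> ball d \<eta>"
      and av: "avoids (G1 \<union> G2) q1 v1" "avoids (G1 \<union> G2) q2 v2" and s: "0 \<le> s" "s \<le> 1"
      and D: "det2 (q2 - q1) v1 > 0" "det2 (q2 - q1) v2 > 0" for q1 q2 v1 v2 s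
  proof -
    have qs: "q1 + s *\<^sub>R (q2 - q1) \<in> ball p r"
      using convexD[OF convex_ball q, of "1 - s" s] s by (simp add: algebra_simps)
    have "closed_segment q1 q2 \<subseteq> ball p r" using q by (simp add: closed_segment_subset)
    moreover have "r > 0" using q(1) by (metis centre_in_ball empty_iff ball_empty not_le)
    then have "ball p r \<subseteq> ball p (8 * r)" by (intro subset_ball) simp
    ultimately have seg: "closed_segment q1 q2 \<inter> G1 = {}" "closed_segment q1 q2 \<inter> G2 = {}"
      using dis by auto
    define a where "a = (1 - s) / det2 (q2 - q1) v1"
    define b where "b = s / det2 (q2 - q1) v2"
    have ab: "a \<ge> 0" "b \<ge> 0" using D s by (auto simp: a_def b_def)
    \<comment> \<open>The swept direction is a positive multiple of a convex combination of the two directions.\<close>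
    have ab0: "a + b > 0"
    proof (cases "s = 0")
      case True then show ?thesis using D by (simp add: a_def b_def)
    next
      case False then have "b > 0" using D s by (simp add: b_def)
      then show ?thesis using ab by simp
    qed
    have "avoids G1 (q1 + s *\<^sub>R (q2 - q1)) (a *\<^sub>R v1 + b *\<^sub>R v2)"
      unfolding a_def b_def
      by (rule sweep[OF G(1) D _ _ seg(1) w1(1) disjI2[OF w1(2)[OF q v]] s]) (use av in \<open>auto simp: avoids_Un\<close>)
    moreover have "avoids G2 (q1 + s *\<^sub>R (q2 - q1)) (a *\<^sub>R v1 + b *\<^sub>R v2)"
      unfolding a_def b_def
      by (rule sweep[OF G(2) D _ _ seg(2) w2(1) disjI2[OF w2(2)[OF q v]] s]) (use av in \<open>auto simp: avoids_Un\<close>)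
    ultimately have "avoids (G1 \<union> G2) (q1 + s *\<^sub>R (q2 - q1)) (a *\<^sub>R v1 + b *\<^sub>R v2)"
      by (simp add: avoids_Un)
    then have "avoids (G1 \<union> G2) (q1 + s *\<^sub>R (q2 - q1)) ((1 / (a + b)) *\<^sub>R (a *\<^sub>R v1 + b *\<^sub>R v2))"
      by (rule avoids_scale) (use ab0 in simp)
    moreover have "(1 / (a + b)) *\<^sub>R (a *\<^sub>R v1 + b *\<^sub>R v2) \<in> ball d \<eta>"
    proof -
      have "(a / (a + b)) *\<^sub>R v1 + (b / (a + b)) *\<^sub>R v2 \<in> ball d \<eta>"
      proof (rule convexD[OF convex_ball v])
        show "a / (a + b) + b / (a + b) = 1"
          using ab0 by (metis add_divide_distrib divide_self less_irrefl)
      qed (use ab ab0 in auto)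
      then show ?thesis by (simp add: scaleR_add_right)
    qed
    ultimately show ?thesis using qs by blast
  qed
  have vd: "v \<bullet> d \<ge> 1/2" "norm v \<le> 3/2" if "v \<in> ball d \<eta>" for v
  proof -
    have 1: "norm (d - v) \<le> 1/2" using that \<eta> by (simp add: dist_norm)
    have "(d - v) \<bullet> d \<le> norm (d - v) * norm d" by (rule norm_cauchy_schwarz)
    then have "d \<bullet> d - v \<bullet> d \<le> 1/2" using 1 d by (simp add: inner_diff_left)
    moreover have "d \<bullet> d = 1" using d by (simp add: dot_square_norm)
    ultimately show "v \<bullet> d \<ge> 1/2" by simp
    have "norm v - norm d \<le> norm (d - v)" by (metis norm_minus_commute norm_triangle_ineq2)
    then show "norm v \<le> 3/2" using 1 d by simp
  qed
  have cone: "avoids (G1 \<union> G2) (q1 + s *\<^sub>R (q2 - q1)) v1"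
    if q: "q1 \<in> ball p r" "q2 \<in> ball p r" and v: "v1 \<in> ball d \<eta>" "v2 \<in> ball d \<eta>"
      and av: "avoids (G1 \<union> G2) q1 v1" "avoids (G1 \<union> G2) q2 v2" and s: "0 \<le> s" "s \<le> 1"
      and ab: "a \<ge> 0" "b \<ge> 0" "q2 - q1 = a *\<^sub>R v1 + b *\<^sub>R v2" for q1 q2 v1 v2 s a b
  proof -
    have "(q2 - q1) \<bullet> d \<le> norm (q2 - q1) * norm d" by (rule norm_cauchy_schwarz)
    also have "norm (q2 - q1) < 2 * r"
      using dist_triangle_less_add[of q2 p r q1 r] q by (simp add: dist_norm[symmetric] dist_commute)
    finally have "(a *\<^sub>R v1 + b *\<^sub>R v2) \<bullet> d < 2 * r" using d ab by simp
    moreover have "a * (1/2) \<le> a * (v1 \<bullet> d)" "b * (1/2) \<le> b * (v2 \<bullet> d)"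
      using mult_left_mono[OF vd(1)[OF v(1)] ab(1)] mult_left_mono[OF vd(1)[OF v(2)] ab(2)] by auto
    ultimately have ab4: "a + b < 4 * r" by (simp add: inner_add_left)
    have near: "q1 + x *\<^sub>R v1 + y *\<^sub>R v2 \<notin> G1 \<union> G2" if "0 \<le> x" "0 \<le> y" "x \<le> a" "y \<le> b" for x y
    proof -
      have "norm (x *\<^sub>R v1 + y *\<^sub>R v2) \<le> x * norm v1 + y * norm v2"
        using that by (intro order_trans[OF norm_triangle_ineq]) auto
      also have "\<dots> \<le> a * (3/2) + b * (3/2)"
        using that vd(2)[OF v(1)] vd(2)[OF v(2)] ab(1,2) by (intro add_mono mult_mono) auto
      finally have "norm (x *\<^sub>R v1 + y *\<^sub>R v2) < 6 * r" using ab4 by simp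
      moreover have "norm (q1 - p) < r" using q by (simp add: dist_norm norm_minus_commute)
      moreover have eq: "q1 + x *\<^sub>R v1 + y *\<^sub>R v2 - p = (q1 - p) + (x *\<^sub>R v1 + y *\<^sub>R v2)" by simp
      ultimately have "norm (q1 + x *\<^sub>R v1 + y *\<^sub>R v2 - p) < 8 * r"
        unfolding eq using norm_triangle_ineq[of "q1 - p" "x *\<^sub>R v1 + y *\<^sub>R v2"] norm_ge_zero[of "q1 - p"] by linarith
      then have "q1 + x *\<^sub>R v1 + y *\<^sub>R v2 \<in> ball p (8 * r)" by (simp add: dist_norm norm_minus_commute)
      then show ?thesis using dis by blast
    qed
    \<comment> \<open>The line of the second ray, prolonged backwards, meets the first ray here.\<close>
    define c where "c = q1 + a *\<^sub>R v1"
    have cv1: "avoids (G1 \<union> G2) c v1" unfolding c_def by (rule avoids_advance[OF av(1) ab(1)])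
    have cv2: "avoids (G1 \<union> G2) c v2" unfolding avoids_def
    proof (intro allI impI)
      fix t :: real assume t: "t \<ge> 0"
      show "c + t *\<^sub>R v2 \<notin> G1 \<union> G2"
      proof (cases "t \<le> b")
        case True
        then show ?thesis using near[of a t] ab t by (simp add: c_def)
      next
        case False
        have "q2 + (t - b) *\<^sub>R v2 \<notin> G1 \<union> G2" using av(2) False by (simp add: avoids_def)
        moreover have "q2 + (t - b) *\<^sub>R v2 = c + t *\<^sub>R v2"
          using ab(3) by (simp add: c_def algebra_simps)
        ultimately show ?thesis by simp
      qed
    qed
    have vd': "v1 \<bullet> d > 0" "v2 \<bullet> d > 0" using vd(1)[OF v(1)] vd(1)[OF v(2)] by linarith+
    have sh: "det2 v1 (g - c) * det2 v2 (g - c) = det2 v1 (g - q1) * det2 v2 (g - q2)" for g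
    proof -
      have "g - c = (g - q1) - a *\<^sub>R v1" "g - c = (g - q2) + b *\<^sub>R v2"
        using ab(3) by (auto simp: c_def algebra_simps)
      then have "det2 v1 (g - c) = det2 v1 (g - q1)" "det2 v2 (g - c) = det2 v2 (g - q2)"
        by (metis det2_diff(2) det2_simps(1) det2_simps(9) diff_zero mult_zero_right,
            metis det2_simps(5) det2_simps(1) det2_simps(9) add.right_neutral mult_zero_right)
      then show ?thesis by simp
    qed
    have far: "c + x *\<^sub>R v1 + y *\<^sub>R v2 \<notin> G1 \<union> G2" if "0 \<le> x" "0 \<le> y" for x y
      using fan[OF G(1) _ _ vd' w1(1) _ that] fan[OF G(2) _ _ vd' w2(1) _ that] cv1 cv2
        w1(2)[OF q v] w2(2)[OF q v] by (auto simp: avoids_Un sh)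
    show ?thesis unfolding avoids_def
    proof (intro allI impI)
      fix t :: real assume t: "t \<ge> 0"
      have sa: "0 \<le> s * a" "0 \<le> s * b" "s * b \<le> b" using s ab by (auto intro: mult_left_le_one_le)
      have eq: "q1 + s *\<^sub>R (q2 - q1) + t *\<^sub>R v1 = q1 + (s * a + t) *\<^sub>R v1 + (s * b) *\<^sub>R v2"
        unfolding ab(3) by (simp add: algebra_simps)
      show "q1 + s *\<^sub>R (q2 - q1) + t *\<^sub>R v1 \<notin> G1 \<union> G2"
      proof (cases "s * a + t \<le> a")
        case True
        then show ?thesis unfolding eq using near[of "s * a + t" "s * b"] sa t by simp
      next
        case False
        have "c + (s * a + t - a) *\<^sub>R v1 + (s * b) *\<^sub>R v2 \<notin> G1 \<union> G2" using False sa by (intro far) auto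
        then show ?thesis unfolding eq c_def by (simp add: algebra_simps)
      qed
    qed
  qed
  have "q1 + s *\<^sub>R (q2 - q1) \<in> ?F" if F: "q1 \<in> ?F" "q2 \<in> ?F" and s: "0 \<le> s" "s \<le> 1" for q1 q2 s
  proof -
    obtain v1 v2 where q: "q1 \<in> ball p r" "q2 \<in> ball p r" and v: "v1 \<in> ball d \<eta>" "v2 \<in> ball d \<eta>"
      and av: "avoids (G1 \<union> G2) q1 v1" "avoids (G1 \<union> G2) q2 v2" using F by auto
    have qs: "q1 + s *\<^sub>R (q2 - q1) \<in> ball p r"
      using convexD[OF convex_ball q, of "1 - s" s] s by (simp add: algebra_simps)
    have sw: "q2 + (1 - s) *\<^sub>R (q1 - q2) = q1 + s *\<^sub>R (q2 - q1)" by (simp add: algebra_simps)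
    define x where "x = det2 (q2 - q1) v1"
    define y where "y = det2 (q2 - q1) v2"
    have xy': "det2 (q1 - q2) v1 = - x" "det2 (q1 - q2) v2 = - y"
      by (auto simp: x_def y_def det2_diff)
    consider "x > 0" "y > 0" | "x < 0" "y < 0" | "x * y \<le> 0"
      by (metis linorder_less_linear mult_pos_neg mult_neg_pos less_imp_le mult_zero_left mult_zero_right order_refl)
    then show ?thesis
    proof cases
      case 1 then show ?thesis using trans[OF q v av s] by (simp add: x_def y_def)
    next
      case 2
      then have "q2 + (1 - s) *\<^sub>R (q1 - q2) \<in> ?F"
        by (intro trans[OF q(2,1) v(2,1) av(2,1)]) (use s xy' in auto)
      then show ?thesis unfolding sw .
    next
      case 3
      have "\<exists>a b. (a \<ge> 0 \<and> b \<ge> 0) \<and> (q2 - q1 = a *\<^sub>R v1 + b *\<^sub>R v2 \<or> q1 - q2 = a *\<^sub>R v1 + b *\<^sub>R v2)"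
      proof (cases "det2 v1 v2 = 0")
        case True
        have v0: "v1 \<bullet> d > 0" "v2 \<bullet> d > 0" using vd(1)[OF v(1)] vd(1)[OF v(2)] by linarith+
        then have v1: "v1 \<noteq> 0" by auto
        define l where "l = (v1 \<bullet> v2) / (v1 \<bullet> v1)"
        have l: "v2 = l *\<^sub>R v1" using det2_eq_0[OF True v1] by (simp add: l_def)
        have "l > 0" using v0 unfolding l by (simp add: zero_less_mult_iff)
        have "y = l * x" unfolding y_def x_def l by simp
        then have "l * x\<^sup>2 \<le> 0" using 3 by (simp add: power2_eq_square mult_ac)
        then have "x = 0" using \<open>l > 0\<close> by (simp add: mult_le_0_iff)
        then have "det2 v1 (q2 - q1) = 0" unfolding x_def by (subst det2_commute) simp
        then have "\<exists>m. q2 - q1 = m *\<^sub>R v1" using det2_eq_0[OF _ v1] by blast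
        then obtain m where m: "q2 - q1 = m *\<^sub>R v1" ..
        show ?thesis
        proof (cases "m \<ge> 0")
          case True then show ?thesis using m by (intro exI[of _ m] exI[of _ 0]) auto
        next
          case False
          have "q1 - q2 = (- m) *\<^sub>R v1" using m by (metis minus_diff_eq scaleR_minus_left)
          then show ?thesis using False by (intro exI[of _ "-m"] exI[of _ 0]) auto
        qed
      next
        case False
        define X where "X = det2 v1 v2"
        have u: "q2 - q1 = (y / X) *\<^sub>R v1 + (- x / X) *\<^sub>R v2"
          using det2_basis[OF False, of "q2 - q1"] det2_commute[of v1 "q2 - q1"] by (simp add: X_def x_def y_def)
        then have u': "q1 - q2 = (- y / X) *\<^sub>R v1 + (x / X) *\<^sub>R v2"
          by (metis (no_types, lifting) minus_diff_eq minus_add_distrib scaleR_minus_left minus_divide_left minus_minus)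
        have "(y / X) * (- x / X) = - (x * y) / (X * X)" by simp
        also have "\<dots> \<ge> 0" using 3 by (intro divide_nonneg_nonneg) auto
        finally have "(y / X \<ge> 0 \<and> - x / X \<ge> 0) \<or> (- y / X \<ge> 0 \<and> x / X \<ge> 0)"
          unfolding zero_le_mult_iff by auto
        then show ?thesis using u u' by blast
      qed
      then obtain a b where ab: "a \<ge> 0" "b \<ge> 0" and
        "q2 - q1 = a *\<^sub>R v1 + b *\<^sub>R v2 \<or> q1 - q2 = a *\<^sub>R v1 + b *\<^sub>R v2" by blast
      then show ?thesis
      proof (elim disjE)
        assume "q2 - q1 = a *\<^sub>R v1 + b *\<^sub>R v2"
        then show ?thesis using cone[OF q v av s ab] v qs by blast
      next
        assume "q1 - q2 = a *\<^sub>R v1 + b *\<^sub>R v2"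
        then have "q1 - q2 = b *\<^sub>R v2 + a *\<^sub>R v1" by simp
        then have "avoids (G1 \<union> G2) (q2 + (1 - s) *\<^sub>R (q1 - q2)) v2"
          by (intro cone[OF q(2,1) v(2,1) av(2,1) _ _ ab(2,1)]) (use s in auto)
        then show ?thesis using v qs unfolding sw by blast
      qed
    qed
  qed
  moreover have "(1 - s) *\<^sub>R q1 + s *\<^sub>R q2 = q1 + s *\<^sub>R (q2 - q1)" for q1 q2 :: complex and s
    by (simp add: algebra_simps)
  ultimately show ?thesis unfolding convex_alt by (metis (no_types, lifting))
qed

text \<open>A supporting line of a convex set at a point that is the midpoint of a segment of the set must contain the
segment.\<close>
lemma half_plane_of_convex:
  fixes p d :: complex
  assumes F: "convex F" and p: "p \<notin> interior F" and e: "e > 0" "p + e *\<^sub>R d \<in> F" "p - e *\<^sub>R d \<in> F"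
  obtains a where "a \<noteq> 0" "a \<bullet> d = 0" "\<And>q. q \<in> F \<Longrightarrow> a \<bullet> (q - p) \<le> 0"
proof -
  have "\<exists>a. a \<noteq> 0 \<and> (\<forall>q\<in>F. a \<bullet> (q - p) \<le> 0)"
  proof (cases "interior F = {}")
    case True
    then obtain a b where ab: "a \<noteq> 0" "F \<subseteq> {x. a \<bullet> x = b}"
      using empty_interior_subset_hyperplane[OF F] by metis
    have "p = (1/2) *\<^sub>R (p + e *\<^sub>R d) + (1/2) *\<^sub>R (p - e *\<^sub>R d)"
      by (simp add: scaleR_add_right scaleR_diff_right flip: scaleR_left_distrib)
    also have "\<dots> \<in> F" by (rule convexD[OF F e(2,3)]) auto
    finally have "a \<bullet> (q - p) = 0" if "q \<in> F" for q
      using ab(2) that by (auto simp: inner_diff_right)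
    then show ?thesis using ab(1) by (auto intro!: exI[of _ a])
  next
    case False
    obtain a b where ab: "a \<noteq> 0" "\<forall>x\<in>interior F. a \<bullet> x \<le> b" "\<forall>x\<in>{p}. b \<le> a \<bullet> x"
      using separating_hyperplane_sets[of "interior F" "{p}"] F p False by (auto simp: convex_interior)
    have "closure (interior F) \<subseteq> {x. a \<bullet> x \<le> b}"
      by (rule closure_minimal) (use ab in \<open>auto simp: closed_halfspace_le\<close>)
    then have "F \<subseteq> {x. a \<bullet> x \<le> b}"
      using convex_closure_interior[OF F False] closure_subset[of F] by blast
    then show ?thesis using ab by (intro exI[of _ a]) (force simp: inner_diff_right)
  qed
  then obtain a where a: "a \<noteq> 0" "\<And>q. q \<in> F \<Longrightarrow> a \<bullet> (q - p) \<le> 0" by blast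
  have "a \<bullet> d = 0" using a(2)[OF e(2)] a(2)[OF e(3)] e(1) by (simp add: mult_le_0_iff zero_le_mult_iff)
  then show thesis using that a by blast
qed

lemma open_point_off_line:
  assumes "open S" "S \<noteq> {}" "d \<noteq> 0"
  obtains g where "g \<in> S" "det2 d (g - p) \<noteq> 0"
proof -
  obtain y where y: "y \<in> S" using assms by auto
  then obtain e where e: "e > 0" "ball y e \<subseteq> S" using assms openE by blast
  define z where "z = y + (e / 2 / norm d) *\<^sub>R (\<i> * d)"
  have "dist y z = e / 2" using e assms by (simp add: z_def dist_norm norm_mult)
  then have z: "z \<in> S" using e by (auto simp: subset_iff)
  have "det2 d (\<i> * d) = (norm d)\<^sup>2" unfolding cmod_power2 by (simp add: det2_def power2_eq_square)
  then have "det2 d (z - p) = det2 d (y - p) + e / 2 / norm d * (norm d)\<^sup>2"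
    by (simp add: z_def det2_diff)
  moreover have "e / 2 / norm d * (norm d)\<^sup>2 > 0" using e assms by simp
  ultimately have "det2 d (y - p) \<noteq> 0 \<or> det2 d (z - p) \<noteq> 0" by linarith
  then show thesis using that y z by blast
qed

text \<open>A point off the line through \<open>p\<close> with direction \<open>d\<close> stays on the same side of all nearby lines.\<close>
lemma det2_sign_stable:
  assumes "det2 d (g - p) \<noteq> 0"
  obtains \<eta> where "\<eta> > 0" "\<And>q q' v v'. q \<in> ball p \<eta> \<Longrightarrow> q' \<in> ball p \<eta> \<Longrightarrow> v \<in> ball d \<eta> \<Longrightarrow> v' \<in> ball d \<eta>
      \<Longrightarrow> det2 v (g - q) * det2 v' (g - q') > 0"
proof -
  define f where "f = (\<lambda>x :: complex \<times> complex. det2 d (g - p) * det2 (snd x) (g - fst x))"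
  have "open {x. f x > 0}" unfolding f_def
    by (intro open_Collect_less continuous_intros)
  moreover have "(p, d) \<in> {x. f x > 0}" using assms by (auto simp: f_def simp flip: power2_eq_square)
  ultimately obtain \<eta> where e: "\<eta> > 0" "ball (p, d) \<eta> \<subseteq> {x. f x > 0}" by (meson openE)
  have 1: "det2 d (g - p) * det2 v (g - q) > 0" if "q \<in> ball p (\<eta>/2)" "v \<in> ball d (\<eta>/2)" for q v
  proof -
    have "dist (p, d) (q, v) \<le> dist p q + dist d v"
      unfolding dist_Pair_Pair using sqrt_sum_squares_le_sum[of "dist p q" "dist d v"] by simp
    then have "(q, v) \<in> ball (p, d) \<eta>" using that by simp
    then show ?thesis using e(2) by (auto simp: f_def)
  qed
  have "det2 v (g - q) * det2 v' (g - q') > 0"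
    if "q \<in> ball p (\<eta>/2)" "q' \<in> ball p (\<eta>/2)" "v \<in> ball d (\<eta>/2)" "v' \<in> ball d (\<eta>/2)" for q q' v v'
    using 1[OF that(1,3)] 1[OF that(2,4)] by (simp add: zero_less_mult_iff) argo
  then show thesis using that[of "\<eta>/2"] e by auto
qed

text \<open>Let \<open>d\<close> be a free direction at a limit \<open>p\<close> of blocked points.  The convex set of nearby points that escape
roughly along \<open>d\<close> contains a piece of the line through \<open>p\<close> with direction \<open>d\<close>, because the ray along \<open>d\<close> from a
point of that line close to \<open>p\<close> is free.  It does not contain a neighbourhood of \<open>p\<close>, so it lies on one side of that
line.\<close>
lemma local_half_plane:
  fixes d :: complex
  assumes G: "connected G1" "connected G2" "open G1" "open G2" "G1 \<noteq> {}" "G2 \<noteq> {}"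
    and \<rho>: "\<rho> > 0" "ball p \<rho> \<inter> (G1 \<union> G2) = {}"
    and d: "norm d = 1" "avoids (G1 \<union> G2) p d"
    and acc: "\<And>e. e > 0 \<Longrightarrow> \<exists>z\<in>ball p e. \<forall>v. v \<noteq> 0 \<longrightarrow> \<not> avoids (G1 \<union> G2) z v"
  obtains a \<eta> where "\<eta> > 0" "a \<noteq> 0" "a \<bullet> d = 0"
    "\<And>q v. q \<in> ball p \<eta> \<Longrightarrow> v \<in> ball d \<eta> \<Longrightarrow> avoids (G1 \<union> G2) q v \<Longrightarrow> a \<bullet> (q - p) \<le> 0"
proof -
  have d0: "d \<noteq> 0" using d by auto
  obtain g1 g2 where g1: "g1 \<in> G1" "det2 d (g1 - p) \<noteq> 0" and g2: "g2 \<in> G2" "det2 d (g2 - p) \<noteq> 0"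
    using open_point_off_line[OF G(3,5) d0] open_point_off_line[OF G(4,6) d0] by metis
  obtain e1 where e1: "e1 > 0" "\<And>q q' v v'. q \<in> ball p e1 \<Longrightarrow> q' \<in> ball p e1 \<Longrightarrow> v \<in> ball d e1 \<Longrightarrow> v' \<in> ball d e1
      \<Longrightarrow> det2 v (g1 - q) * det2 v' (g1 - q') > 0" using det2_sign_stable[OF g1(2)] by blast
  obtain e2 where e2: "e2 > 0" "\<And>q q' v v'. q \<in> ball p e2 \<Longrightarrow> q' \<in> ball p e2 \<Longrightarrow> v \<in> ball d e2 \<Longrightarrow> v' \<in> ball d e2
      \<Longrightarrow> det2 v (g2 - q) * det2 v' (g2 - q') > 0" using det2_sign_stable[OF g2(2)] by blast
  define r where "r = Min {\<rho> / 8, e1, e2, 1/2}"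
  have r: "r > 0" "r \<le> \<rho> / 8" "r \<le> e1" "r \<le> e2" "r \<le> 1/2" using \<rho> e1 e2 by (auto simp: r_def)
  define F where "F = {q \<in> ball p r. \<exists>v\<in>ball d r. avoids (G1 \<union> G2) q v}"
  have "ball p (8 * r) \<subseteq> ball p \<rho>" using r by (intro subset_ball) simp
  then have "convex F" unfolding F_def
    by (intro convex_near[OF G(1,2) _ d(1) r(5) g1(1) _ g2(1)] e1(2) e2(2)) (use r \<rho>(2) in auto)
  moreover have "p \<notin> interior F"
  proof
    assume "p \<in> interior F"
    then obtain e where e: "e > 0" "ball p e \<subseteq> F" using mem_interior by blast
    obtain z where z: "z \<in> ball p e" "\<forall>v. v \<noteq> 0 \<longrightarrow> \<not> avoids (G1 \<union> G2) z v" using acc[OF e(1)] by blast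
    then obtain v where "v \<in> ball d r" "avoids (G1 \<union> G2) z v" using e by (auto simp: F_def)
    moreover from this have "v \<noteq> 0" using d r by (auto simp: dist_norm)
    ultimately show False using z by blast
  qed
  moreover have "p + t *\<^sub>R d \<in> F" if t: "\<bar>t\<bar> < r" for t
  proof -
    have "avoids (G1 \<union> G2) (p + t *\<^sub>R d) d" unfolding avoids_def
    proof (intro allI impI)
      fix s :: real assume s: "s \<ge> 0"
      have eq: "p + t *\<^sub>R d + s *\<^sub>R d = p + (t + s) *\<^sub>R d" by (simp add: algebra_simps)
      show "p + t *\<^sub>R d + s *\<^sub>R d \<notin> G1 \<union> G2"
      proof (cases "t + s \<ge> 0")
        case True then show ?thesis unfolding eq using d(2) by (auto simp: avoids_def)
      next
        case False
        then have "p + (t + s) *\<^sub>R d \<in> ball p \<rho>" using d t s r by (simp add: dist_norm)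
        then show ?thesis unfolding eq using \<rho> by blast
      qed
    qed
    then show ?thesis unfolding F_def using t d r by (auto simp: dist_norm intro!: bexI[of _ d])
  qed
  from this[of "r/2"] this[of "- r/2"] have "p + (r/2) *\<^sub>R d \<in> F" "p - (r/2) *\<^sub>R d \<in> F" using r by auto
  ultimately obtain a where "a \<noteq> 0" "a \<bullet> d = 0" "\<And>q. q \<in> F \<Longrightarrow> a \<bullet> (q - p) \<le> 0"
    using half_plane_of_convex[of F p "r/2" d] r by auto
  then show thesis using that[of r a] r(1) unfolding F_def by blast
qed

text \<open>Upper semicontinuity of the set of free directions, by compactness of the circle: a limit of free rays of
an open set is free.\<close>
lemma free_directions_near:
  assumes G: "open G" and e: "e > 0"
  obtains r where "r > 0" "\<And>q v. q \<in> ball p r \<Longrightarrow> norm v = 1 \<Longrightarrow> avoids G q v \<Longrightarrow>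
     \<exists>d. norm d = 1 \<and> avoids G p d \<and> v \<in> ball d e"
proof -
  have "\<exists>r>0. \<forall>q v. q \<in> ball p r \<longrightarrow> norm v = 1 \<longrightarrow> avoids G q v \<longrightarrow>
     (\<exists>d. norm d = 1 \<and> avoids G p d \<and> v \<in> ball d e)"
  proof (rule ccontr)
    assume neg: "\<not> ?thesis"
    have "\<exists>q v. q \<in> ball p (1 / real (Suc n)) \<and> norm v = 1 \<and> avoids G q v \<and>
        (\<forall>d. norm d = 1 \<longrightarrow> avoids G p d \<longrightarrow> v \<notin> ball d e)" for n
      using neg by (metis of_nat_0_less_iff zero_less_Suc zero_less_divide_1_iff)
    then obtain q v where q: "\<And>n. q n \<in> ball p (1 / real (Suc n))" and v: "\<And>n. norm (v n) = 1"
      and av: "\<And>n. avoids G (q n) (v n)"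
      and no: "\<And>n d. norm d = 1 \<Longrightarrow> avoids G p d \<Longrightarrow> v n \<notin> ball d e" by metis
    have ql: "q \<longlonglongrightarrow> p"
    proof (rule metric_LIMSEQ_I)
      fix r :: real assume "r > 0"
      then obtain N where N: "1 / real (Suc N) < r" using nat_approx_posE by blast
      have "dist (q n) p < r" if "n \<ge> N" for n
      proof -
        have "1 / real (Suc n) \<le> 1 / real (Suc N)" using that by (simp add: field_simps)
        then show ?thesis using q[of n] N by (simp add: dist_commute)
      qed
      then show "\<exists>N. \<forall>n\<ge>N. dist (q n) p < r" by blast
    qed
    have "compact (sphere (0::complex) 1)" by simp
    then obtain w s where w: "w \<in> sphere 0 1" "strict_mono s" "(v \<circ> s) \<longlonglongrightarrow> w"
      using v unfolding compact_def by (metis dist_0_norm mem_sphere)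
    have qs: "(q \<circ> s) \<longlonglongrightarrow> p" using ql w(2) LIMSEQ_subseq_LIMSEQ by blast
    have "avoids G p w" unfolding avoids_def
    proof (intro allI impI notI)
      fix t :: real assume t: "t \<ge> 0" "p + t *\<^sub>R w \<in> G"
      have "(\<lambda>n. (q \<circ> s) n + t *\<^sub>R (v \<circ> s) n) \<longlonglongrightarrow> p + t *\<^sub>R w" by (intro tendsto_intros qs w(3))
      then have "eventually (\<lambda>n. (q \<circ> s) n + t *\<^sub>R (v \<circ> s) n \<in> G) sequentially"
        using G t topological_tendstoD by blast
      then obtain n where "q (s n) + t *\<^sub>R v (s n) \<in> G" by (auto simp: eventually_sequentially)
      then show False using av[of "s n"] t by (auto simp: avoids_def)
    qed
    moreover have "eventually (\<lambda>n. dist ((v \<circ> s) n) w < e) sequentially" using w(3) e tendstoD by blast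
    then obtain n where "v (s n) \<in> ball w e" by (auto simp: eventually_sequentially dist_commute)
    ultimately show False using no w(1) by auto
  qed
  then show thesis using that by blast
qed

text \<open>If a whole arc of directions is free at \<open>p\<close>, then the middle direction stays free at nearby points, since a
ray starting near \<open>p\<close> soon enters the free cone of directions at \<open>p\<close>.\<close>
lemma free_arc_stable:
  assumes \<rho>: "\<rho> > 0" "ball p \<rho> \<inter> G = {}" and e: "e > 0" and u: "norm u = 1"
    and free: "\<And>w. w \<in> ball u e \<Longrightarrow> avoids G p w"
  obtains r where "r > 0" "\<And>q. q \<in> ball p r \<Longrightarrow> avoids G q u"
proof -
  define r where "r = min (\<rho> / 2) (e * \<rho> / 2)"
  have r: "r > 0" "r \<le> \<rho> / 2" "r \<le> e * \<rho> / 2" using \<rho> e by (auto simp: r_def)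
  have "avoids G q u" if q: "q \<in> ball p r" for q unfolding avoids_def
  proof (intro allI impI)
    fix t :: real assume t: "t \<ge> 0"
    have qp: "norm (q - p) < r" using q by (simp add: dist_norm norm_minus_commute)
    show "q + t *\<^sub>R u \<notin> G"
    proof (cases "t < \<rho> / 2")
      case True
      have "norm ((q - p) + t *\<^sub>R u) \<le> norm (q - p) + t"
        using norm_triangle_ineq[of "q - p" "t *\<^sub>R u"] u t by simp
      moreover have "dist p (q + t *\<^sub>R u) = norm ((q - p) + t *\<^sub>R u)"
        by (metis add_diff_eq diff_add_eq dist_commute dist_norm)
      ultimately have "q + t *\<^sub>R u \<in> ball p \<rho>" using qp r True by simp
      then show ?thesis using \<rho> by blast
    next
      case False
      then have t0: "t > 0" using \<rho> by simp
      define w where "w = u + (1 / t) *\<^sub>R (q - p)"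
      have "norm (q - p) < e * t"
      proof -
        have "e * (\<rho> / 2) \<le> e * t" using False e by (intro mult_left_mono) auto
        then show ?thesis using qp r by simp
      qed
      then have "w \<in> ball u e" using t0 by (simp add: w_def dist_norm divide_simps)
      then have "p + t *\<^sub>R w \<notin> G" using free t by (auto simp: avoids_def)
      then show ?thesis using t0 by (simp add: w_def scaleR_add_right algebra_simps)
    qed
  qed
  then show thesis using that r by blast
qed

section \<open>Free directions at a limit of blocked points\<close>

text \<open>Cut the circle of directions at the free direction \<open>d\<close> and measure angles from \<open>- d\<close>.  The directions that
hit a connected set form an interval of angles.  If there were two more free directions, they would cut the
angles into three intervals, each hit by one of the obstacles; two of these are hit by the same
obstacle, which then also hits a free direction in between.\<close>
lemma at_most_two_free_directions:
  assumes G: "connected G1" "connected G2"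
    and d: "norm d = 1" "avoids (G1 \<union> G2) p d"
    and dense: "\<And>u e. norm u = 1 \<Longrightarrow> e > 0 \<Longrightarrow> \<exists>w\<in>ball u e. \<not> avoids (G1 \<union> G2) p w"
  obtains e where "norm e = 1" "avoids (G1 \<union> G2) p e"
    "\<And>v. norm v = 1 \<Longrightarrow> avoids (G1 \<union> G2) p v \<Longrightarrow> v = d \<or> v = e"
proof -
  define G where "G = G1 \<union> G2"
  define h where "h y = Arg ((y - p) / (- d))" for y
  have d0: "d \<noteq> 0" using d by auto
  have pG: "p \<notin> G" using avoidsD[OF d(2), of 0] by (simp add: G_def)
  have polar: "z = of_real (norm z) * cis (Arg z)" for z
    using rcis_cmod_Arg[of z] by (simp add: rcis_def)
  have nonpos: "(y - p) / (- d) \<notin> \<real>\<^sub>\<le>\<^sub>0" if y: "y \<in> G" for y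
  proof
    assume "(y - p) / (- d) \<in> \<real>\<^sub>\<le>\<^sub>0"
    then obtain t where t: "(y - p) / (- d) = of_real t" "t \<le> 0" by (rule nonpos_Reals_cases)
    then have "y = p + (- t) *\<^sub>R d" using d0 by (simp add: field_simps scaleR_conv_of_real)
    then show False using avoidsD[OF d(2), of "-t"] t y by (simp add: G_def)
  qed
  have avoid_angle: "h y \<noteq> Arg (v / (- d))" if v: "norm v = 1" "avoids G p v" and y: "y \<in> G" for v y
  proof
    assume h: "h y = Arg (v / (- d))"
    have nv: "norm (v / (- d)) = 1" "norm ((y - p) / (- d)) = norm (y - p)"
      using v d by (auto simp: norm_divide)
    have "(y - p) / (- d) = of_real (norm (y - p)) * cis (Arg (v / (- d)))"
      using polar[of "(y - p) / (- d)"] h nv(2) unfolding h_def by simp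
    also have "cis (Arg (v / (- d))) = v / (- d)" by (metis polar nv(1) of_real_1 mult_1)
    finally have "y = p + norm (y - p) *\<^sub>R v" using d0 by (simp add: field_simps scaleR_conv_of_real)
    then show False using avoidsD[OF v(2), of "norm (y - p)"] y by simp
  qed
  have hit: "\<exists>y\<in>G. a < h y \<and> h y < b" if ab: "- pi \<le> a" "a < b" "b \<le> pi" for a b
  proof -
    define m where "m = (a + b) / 2"
    define u where "u = - d * cis m"
    have m: "a < m" "m < b" "- pi < m" "m < pi" using ab by (auto simp: m_def)
    have ud: "u / (- d) = cis m" using d0 by (simp add: u_def)
    have Am: "Arg (u / (- d)) = m" unfolding ud using m by (intro cis_Arg_unique) (auto simp: sgn_div_norm)
    then have "u / (- d) \<notin> \<real>\<^sub>\<le>\<^sub>0" using m ud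
      by (metis Arg_eq_pi cis_neq_zero complex_nonpos_Reals_iff less_irrefl order_le_less zero_complex.simps complex_eq_iff)
    then have "isCont (\<lambda>w. Arg (w / (- d))) u"
      using d0 by (intro isCont_o2[where f = "\<lambda>w. w / (- d)" and g = Arg] continuous_at_Arg) auto
    then have "((\<lambda>w. Arg (w / (- d))) \<longlongrightarrow> m) (at u)" unfolding continuous_at Am .
    then have "eventually (\<lambda>w. dist (Arg (w / (- d))) m < (b - a) / 2) (at u)"
      using ab by (intro tendstoD) auto
    then obtain \<epsilon> where \<epsilon>: "\<epsilon> > 0" "\<And>w. w \<noteq> u \<Longrightarrow> dist w u < \<epsilon> \<Longrightarrow> dist (Arg (w / (- d))) m < (b - a) / 2"
      unfolding eventually_at by auto
    have nu: "norm u = 1" using d by (simp add: u_def norm_mult)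
    obtain w where w: "w \<in> ball u \<epsilon>" "\<not> avoids G p w" using dense[OF nu \<epsilon>(1)] by (auto simp: G_def)
    have "dist (Arg (w / (- d))) m < (b - a) / 2"
      using \<epsilon>(2)[of w] w(1) Am ab by (cases "w = u") (auto simp: dist_commute)
    then have Aw: "a < Arg (w / (- d))" "Arg (w / (- d)) < b"
      by (auto simp: m_def dist_real_def abs_less_iff field_simps)
    obtain t where t: "t \<ge> 0" "p + t *\<^sub>R w \<in> G" using w(2) by (auto simp: avoids_def)
    then have t0: "t > 0" using pG by (cases "t = 0") auto
    have "h (p + t *\<^sub>R w) = Arg (of_real t * (w / (- d)))" by (simp add: h_def scaleR_conv_of_real)
    also have "\<dots> = Arg (w / (- d))" by (rule Arg_times_of_real[OF t0])
    finally show ?thesis using Aw t(2) by (intro bexI[of _ "p + t *\<^sub>R w"]) auto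
  qed
  have conn: "connected (h ` S)" if "connected S" "S \<subseteq> G" for S
    unfolding h_def
    by (rule connected_continuous_image[OF _ that(1)], intro continuous_intros) (use d0 nonpos that(2) in auto)
  have Arg_in: "- pi < Arg (v / (- d))" "Arg (v / (- d)) < pi" if v: "norm v = 1" "v \<noteq> d" for v
  proof -
    show "- pi < Arg (v / (- d))" by (rule mpi_less_Arg)
    have "Arg (v / (- d)) \<noteq> pi"
    proof
      assume "Arg (v / (- d)) = pi"
      then have "v / (- d) = - 1" using polar[of "v / (- d)"] v d by (simp add: norm_divide)
      then show False using v d0 by (simp add: field_simps)
    qed
    then show "Arg (v / (- d)) < pi" using Arg_le_pi[of "v / (- d)"] by simp
  qed
  have two: False if e: "norm e = 1" "avoids G p e" "e \<noteq> d" and f: "norm f = 1" "avoids G p f" "f \<noteq> d"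
      and lt: "Arg (e / (- d)) < Arg (f / (- d))" for e f
  proof -
    note Ae = Arg_in[OF e(1,3)] and Af = Arg_in[OF f(1,3)]
    obtain y1 where y1: "y1 \<in> G" "h y1 < Arg (e / (- d))" using hit[of "- pi" "Arg (e / (- d))"] Ae by auto
    obtain y2 where y2: "y2 \<in> G" "Arg (e / (- d)) < h y2" "h y2 < Arg (f / (- d))"
      using hit[of "Arg (e / (- d))" "Arg (f / (- d))"] Ae Af lt by auto
    obtain y3 where y3: "y3 \<in> G" "Arg (f / (- d)) < h y3" using hit[of "Arg (f / (- d))" pi] Af by auto
    have sep: "\<not> (x \<in> S \<and> y \<in> S)" if S: "connected S" "S \<subseteq> G"
        and x: "h x < Arg (v / (- d))" "Arg (v / (- d)) < h y" and v: "norm v = 1" "avoids G p v" for S x y v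
    proof
      assume xy: "x \<in> S \<and> y \<in> S"
      have "Arg (v / (- d)) \<in> h ` S"
        by (rule connectedD_interval[OF conn[OF S], of "h x" "h y"]) (use xy x in auto)
      then show False using avoid_angle[OF v] S(2) by (metis imageE subsetD)
    qed
    have sub: "G1 \<subseteq> G" "G2 \<subseteq> G" by (auto simp: G_def)
    note s1 = sep[OF G(1) sub(1)] and s2 = sep[OF G(2) sub(2)]
    have "\<not> (y1 \<in> G1 \<and> y2 \<in> G1)" "\<not> (y1 \<in> G2 \<and> y2 \<in> G2)"
      using s1[OF y1(2) y2(2) e(1,2)] s2[OF y1(2) y2(2) e(1,2)] by auto
    moreover have "\<not> (y2 \<in> G1 \<and> y3 \<in> G1)" "\<not> (y2 \<in> G2 \<and> y3 \<in> G2)"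
      using s1[OF y2(3) y3(2) f(1,2)] s2[OF y2(3) y3(2) f(1,2)] by auto
    moreover have "h y1 < Arg (f / (- d))" using y1 lt by simp
    then have "\<not> (y1 \<in> G1 \<and> y3 \<in> G1)" "\<not> (y1 \<in> G2 \<and> y3 \<in> G2)"
      using s1[OF _ y3(2) f(1,2)] s2[OF _ y3(2) f(1,2)] by auto
    ultimately show False using y1(1) y2(1) y3(1) unfolding G_def by blast
  qed
  have one: "e = f" if e: "norm e = 1" "avoids G p e" "e \<noteq> d" and f: "norm f = 1" "avoids G p f" "f \<noteq> d" for e f
  proof -
    have "Arg (e / (- d)) = Arg (f / (- d))" using two[OF e f] two[OF f e] by (metis linorder_less_linear)
    then have "e / (- d) = f / (- d)"
      using polar[of "e / (- d)"] polar[of "f / (- d)"] e f d by (simp add: norm_divide)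
    then show ?thesis using d0 by simp
  qed
  show thesis
  proof (cases "\<exists>e. norm e = 1 \<and> avoids G p e \<and> e \<noteq> d")
    case True
    then obtain e where e: "norm e = 1" "avoids G p e" "e \<noteq> d" by blast
    then have "v = d \<or> v = e" if "norm v = 1" "avoids G p v" for v
      using one[OF that _ e] that by (cases "v = d") auto
    then show ?thesis using that[of e] e unfolding G_def by blast
  next
    case False
    then have "v = d \<or> v = d" if "norm v = 1" "avoids G p v" for v using that by blast
    then show ?thesis using that[of d] d unfolding G_def by blast
  qed
qed

lemma one_side_of_line:
  assumes S: "connected S" and d: "d \<noteq> 0" and av: "avoids S p d" "avoids S p (- d)"
  shows "(\<forall>y\<in>S. det2 d (y - p) > 0) \<or> (\<forall>y\<in>S. det2 d (y - p) < 0)"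
proof -
  have "0 \<notin> (\<lambda>y. det2 d (y - p)) ` S"
  proof
    assume "0 \<in> (\<lambda>y. det2 d (y - p)) ` S"
    then obtain y where y: "y \<in> S" "det2 d (y - p) = 0" by auto
    then obtain t where "y - p = t *\<^sub>R d" using det2_eq_0[OF _ d] by blast
    then have t: "y = p + t *\<^sub>R d" by (simp add: algebra_simps)
    then show False using y avoidsD[OF av(1), of t] avoidsD[OF av(2), of "-t"] by (cases "t \<ge> 0") auto
  qed
  moreover have "connected ((\<lambda>y. det2 d (y - p)) ` S)"
    by (intro connected_continuous_image[OF _ S] continuous_intros)
  ultimately have no: "\<not> (x \<le> 0 \<and> 0 \<le> y)" if "x \<in> (\<lambda>y. det2 d (y - p)) ` S" "y \<in> (\<lambda>y. det2 d (y - p)) ` S" for x y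
    using connectedD_interval that by blast
  then have "det2 d (y - p) > 0 \<longleftrightarrow> det2 d (x - p) > 0" "det2 d (y - p) \<noteq> 0" if "x \<in> S" "y \<in> S" for x y
    using no[of "det2 d (y - p)" "det2 d (x - p)"] no[of "det2 d (x - p)" "det2 d (y - p)"]
      no[of "det2 d (y - p)" "det2 d (y - p)"] that by auto
  then show ?thesis by (metis linorder_less_linear)
qed

text \<open>Suppose that a bounded set lies at positive distance beyond a line through \<open>p\<close>, with normal \<open>n\<close>, and is hit
in directions arbitrarily close to \<open>d\<close>.  The hits lie at bounded distance, so \<open>d\<close> points strictly to
that side of the line.\<close>
lemma limit_direction_positive:
  fixes G1 :: "complex set"
  assumes bd: "G1 \<subseteq> ball p R" and m: "m > 0" "\<And>y. y \<in> G1 \<Longrightarrow> n \<bullet> (y - p) \<ge> m"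
    and nrm: "norm d = 1" "norm w = 1"
    and hit: "\<And>k. k > 0 \<Longrightarrow> k \<le> 1/2 \<Longrightarrow> \<exists>t\<ge>0. p + t *\<^sub>R (d + k *\<^sub>R w) \<in> G1"
  shows "n \<bullet> d > 0"
proof (rule ccontr)
  assume "\<not> n \<bullet> d > 0"
  then have nd: "n \<bullet> d \<le> 0" by simp
  obtain t0 where "p + t0 *\<^sub>R (d + (1/2) *\<^sub>R w) \<in> G1" using hit[of "1/2"] by auto
  then have R: "R > 0" using bd by (metis ball_eq_empty empty_iff not_le subsetD)
  \<comment> \<open>Small enough that a hit within distance \<open>R\<close> cannot gain the height \<open>m\<close>; hits have parameter below \<open>2 * R\<close>.\<close>
  define k where "k = min (1/2) (m / (4 * R * (\<bar>n \<bullet> w\<bar> + 1)))"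
  have k: "k > 0" "k \<le> 1/2" "k \<le> m / (4 * R * (\<bar>n \<bullet> w\<bar> + 1))" using R m by (auto simp: k_def)
  obtain t where t: "t \<ge> 0" "p + t *\<^sub>R (d + k *\<^sub>R w) \<in> G1" using hit[OF k(1,2)] by blast
  have "norm (t *\<^sub>R (d + k *\<^sub>R w)) < R" using bd t(2) by (auto simp: dist_norm subset_iff)
  then have tR: "t * norm (d + k *\<^sub>R w) < R" using t by simp
  have "norm d - norm (k *\<^sub>R w) \<le> norm (d + k *\<^sub>R w)"
    by (metis norm_diff_ineq)
  then have "1/2 \<le> norm (d + k *\<^sub>R w)" using nrm k by simp
  then have "t * (1/2) \<le> t * norm (d + k *\<^sub>R w)" using t by (intro mult_left_mono) auto
  then have t2: "t < 2 * R" using tR by simp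
  have "m \<le> n \<bullet> (t *\<^sub>R (d + k *\<^sub>R w))" using m(2)[OF t(2)] by simp
  also have "\<dots> = t * (n \<bullet> d) + t * (k * (n \<bullet> w))" by (simp add: inner_add_right algebra_simps)
  also have "\<dots> \<le> 0 + t * (k * (n \<bullet> w))" using t nd by (simp add: mult_nonneg_nonpos)
  also have "\<dots> \<le> t * (k * (\<bar>n \<bullet> w\<bar> + 1))" using t k by (simp add: mult_left_mono)
  also have "\<dots> \<le> (2 * R) * (k * (\<bar>n \<bullet> w\<bar> + 1))" using t2 k by (intro mult_right_mono) auto
  also have "k * (\<bar>n \<bullet> w\<bar> + 1) \<le> m / (4 * R)"
  proof -
    define C where "C = \<bar>n \<bullet> w\<bar> + 1"
    have "C > 0" by (simp add: C_def)
    moreover have "k \<le> m / (4 * R * C)" using k(3) by (simp add: C_def)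
    ultimately have "k * C \<le> m / (4 * R)" using R by (simp add: field_simps)
    then show ?thesis by (simp add: C_def)
  qed
  then have "(2 * R) * (k * (\<bar>n \<bullet> w\<bar> + 1)) \<le> (2 * R) * (m / (4 * R))" using R by (intro mult_left_mono) auto
  also have "\<dots> = m / 2" using R by simp
  finally show False using m by simp
qed

lemma not_extreme_midpoint:
  assumes "p extreme_point_of (convex hull S)" "p + w \<in> S" "p - w \<in> S"
  shows "w = (0::'a::real_normed_vector)"
proof (rule ccontr)
  assume w: "w \<noteq> 0"
  have "p = midpoint (p + w) (p - w)" by (simp add: midpoint_def flip: scaleR_2)
  moreover have "p + w \<noteq> p - w" using w by (simp add: eq_neg_iff_add_eq_0 flip: scaleR_2)
  ultimately have "p \<in> open_segment (p + w) (p - w)" by (metis midpoint_in_open_segment)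
  then show False using assms hull_subset[of S convex] by (auto simp: extreme_point_of_def)
qed

section \<open>Trapped points\<close>

definition trapped :: "complex set \<Rightarrow> complex set \<Rightarrow> complex set" where
  "trapped G W = {z \<in> W. \<forall>v. v \<noteq> 0 \<longrightarrow> \<not> avoids G z v}"

lemma trapped_disjoint: "trapped G W \<inter> G = {}" if "W \<inter> G = {}"
  using that by (auto simp: trapped_def)

lemma trappedD: "z \<in> trapped G W \<Longrightarrow> v \<noteq> 0 \<Longrightarrow> \<exists>t\<ge>0. z + t *\<^sub>R v \<in> G"
  by (auto simp: trapped_def avoids_def)

lemma open_trapped:
  assumes "open G" "open W" shows "open (trapped G W)"
  unfolding open_contains_ball
proof
  fix z assume z: "z \<in> trapped G W"
  obtain r where r: "r > 0" "\<And>q v. q \<in> ball z r \<Longrightarrow> norm v = 1 \<Longrightarrow> avoids G q v \<Longrightarrow>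
     \<exists>d. norm d = 1 \<and> avoids G z d \<and> v \<in> ball d 1" using free_directions_near[OF assms(1), of 1] by auto
  obtain s where s: "s > 0" "ball z s \<subseteq> W" using z assms(2) openE unfolding trapped_def by blast
  have "q \<in> trapped G W" if q: "q \<in> ball z (min r s)" for q
  proof -
    have "\<not> avoids G q v" if v: "v \<noteq> 0" for v
    proof
      assume "avoids G q v"
      then have "avoids G q ((1 / norm v) *\<^sub>R v)" by (rule avoids_scale) simp
      then obtain d where "norm d = 1" "avoids G z d" using r(2)[of q "(1 / norm v) *\<^sub>R v"] q v by auto
      moreover from this have "d \<noteq> 0" by auto
      ultimately show False using z by (auto simp: trapped_def)
    qed
    then show ?thesis using q s by (auto simp: trapped_def)
  qed
  then show "\<exists>e>0. ball z e \<subseteq> trapped G W" using r s by (intro exI[of _ "min r s"]) auto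
qed

lemma bounded_trapped:
  assumes "bounded G" shows "bounded (trapped G W)"
proof -
  obtain R where R: "\<And>y. y \<in> G \<Longrightarrow> norm y \<le> R" "R > 0" using assms by (meson bounded_pos)
  have "norm z \<le> R" if z: "z \<in> trapped G W" for z
  proof (rule ccontr)
    assume n: "\<not> norm z \<le> R"
    then have "z \<noteq> 0" using R by auto
    then obtain t where t: "t \<ge> 0" "z + t *\<^sub>R z \<in> G" using trappedD[OF z] by blast
    have "norm z \<le> (1 + t) * norm z" using t by (simp add: algebra_simps)
    also have "\<dots> = norm (z + t *\<^sub>R z)" using t by (simp add: scaleR_left_distrib[of 1 t z, simplified, symmetric])
    finally show False using R(1)[OF t(2)] n by simp
  qed
  then show ?thesis by (rule boundedI)
qed

text \<open>Let \<open>p\<close> have exactly the free directions \<open>d\<close> and \<open>e\<close>, with \<open>G1\<close> in the convex sector between them and \<open>G2\<close>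
outside.  No trapped point of this sector is visible from \<open>p\<close>.  Otherwise walk from \<open>p\<close> through that point on
towards \<open>G1\<close>.  The walk must leave the trapped set before it reaches \<open>G1\<close>, at a point \<open>q\<close> that
has a free ray.  Sweeping this ray into the free ray at \<open>p\<close> on the same side of the walk frees all
points passed on the way, among them the trapped point.  Both obstacles hit directions on the other side of the
walk, so neither is enclosed by the sweep.\<close>
lemma not_trapped_in_sector:
  assumes G: "connected G1" "connected G2" "open G1" "open G2" and W: "open W" "W \<inter> (G1 \<union> G2) = {}"
    and cl: "closure (trapped (G1 \<union> G2) W) \<subseteq> W"
    and de: "det2 e d > 0" and av: "avoids (G1 \<union> G2) p d" "avoids (G1 \<union> G2) p e"
    and only: "\<And>v. v \<noteq> 0 \<Longrightarrow> avoids (G1 \<union> G2) p v \<Longrightarrow> \<exists>c>0. v = c *\<^sub>R d \<or> v = c *\<^sub>R e"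
    and G1: "\<And>y. y \<in> G1 \<Longrightarrow> \<exists>a>0. \<exists>b>0. y = p + a *\<^sub>R d + b *\<^sub>R e"
    and G2: "\<And>a b. a \<ge> 0 \<Longrightarrow> b \<ge> 0 \<Longrightarrow> p + a *\<^sub>R d + b *\<^sub>R e \<notin> G2"
    and z: "p + a *\<^sub>R d + b *\<^sub>R e \<in> trapped (G1 \<union> G2) W" "a > 0" "b > 0"
    and seg: "closed_segment p (p + a *\<^sub>R d + b *\<^sub>R e) \<inter> (G1 \<union> G2) = {}"
  shows False
proof -
  define G where "G = G1 \<union> G2"
  define Z where "Z = trapped G W"
  define u where "u = a *\<^sub>R d + b *\<^sub>R e"
  have zu: "p + u \<in> Z" using z by (simp add: u_def Z_def G_def add.assoc)
  have ZG: "Z \<inter> G = {}" using trapped_disjoint W by (simp add: Z_def G_def)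
  have oZ: "open Z" unfolding Z_def G_def by (intro open_trapped open_Un G W)
  have ud: "det2 u d > 0" using de z by (simp add: u_def det2_commute[of d])
  have ue: "det2 u e < 0" using de z det2_commute[of d e] by (simp add: u_def)
  have u0: "u \<noteq> 0" using ud by auto
  have hit: "\<exists>t\<ge>0. p + t *\<^sub>R v \<in> G" if "v \<noteq> 0" "\<And>c. c > 0 \<Longrightarrow> v \<noteq> c *\<^sub>R d" "\<And>c. c > 0 \<Longrightarrow> v \<noteq> c *\<^sub>R e" for v
    using only[OF that(1)] that(2,3) unfolding avoids_def G_def by blast
  have hit': "\<exists>t\<ge>0. p + t *\<^sub>R v \<in> G" if "det2 d v \<noteq> 0" "det2 e v \<noteq> 0" for v
    by (rule hit) (use that in auto)
  have pG: "p \<notin> G" using avoidsD[OF av(1), of 0] by (simp add: G_def)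
  \<comment> \<open>Inside the sector only the first obstacle is hit, strictly outside only the second.\<close>
  have hit1: "\<exists>t>0. p + t *\<^sub>R (x *\<^sub>R d + y *\<^sub>R e) \<in> G1" if xy: "x > 0" "y > 0" for x y
  proof -
    have "det2 d (x *\<^sub>R d + y *\<^sub>R e) \<noteq> 0" "det2 e (x *\<^sub>R d + y *\<^sub>R e) \<noteq> 0"
      using xy de by (auto simp: det2_commute[of d e])
    note nz = this
    obtain t where t: "t \<ge> 0" "p + t *\<^sub>R (x *\<^sub>R d + y *\<^sub>R e) \<in> G"
      using hit'[OF nz] by blast
    have "p + t *\<^sub>R (x *\<^sub>R d + y *\<^sub>R e) \<notin> G2" using G2[of "t * x" "t * y"] t xy by (simp add: scaleR_add_right add.assoc)
    moreover have "t \<noteq> 0" using t(2) pG by (metis add.right_neutral scaleR_zero_left)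
    ultimately show ?thesis using t by (auto simp: G_def intro!: exI[of _ t])
  qed
  have hit2: "\<exists>t>0. p + t *\<^sub>R (x *\<^sub>R d + y *\<^sub>R e) \<in> G2" if xy: "x * y < 0" for x y
  proof -
    have nz: "x \<noteq> 0" "y \<noteq> 0" using xy by auto
    have "det2 d (x *\<^sub>R d + y *\<^sub>R e) \<noteq> 0" "det2 e (x *\<^sub>R d + y *\<^sub>R e) \<noteq> 0"
      using nz de by (auto simp: det2_commute[of d e])
    note nz = this
    obtain t where t: "t \<ge> 0" "p + t *\<^sub>R (x *\<^sub>R d + y *\<^sub>R e) \<in> G"
      using hit'[OF nz] by blast
    have t0: "t \<noteq> 0" using t(2) pG by (metis add.right_neutral scaleR_zero_left)
    have "p + t *\<^sub>R (x *\<^sub>R d + y *\<^sub>R e) \<notin> G1"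
    proof
      assume "p + t *\<^sub>R (x *\<^sub>R d + y *\<^sub>R e) \<in> G1"
      then obtain a' b' where ab: "a' > 0" "b' > 0"
        "p + t *\<^sub>R (x *\<^sub>R d + y *\<^sub>R e) = p + a' *\<^sub>R d + b' *\<^sub>R e" using G1 by blast
      then have eq: "t *\<^sub>R (x *\<^sub>R d + y *\<^sub>R e) = a' *\<^sub>R d + b' *\<^sub>R e" by (simp add: add.assoc)
      have "t * x * det2 e d = a' * det2 e d" using arg_cong[OF eq, of "det2 e"] by simp
      moreover have "t * y * det2 d e = b' * det2 d e" using arg_cong[OF eq, of "det2 d"] by simp
      ultimately have "t * x = a'" "t * y = b'" using de det2_commute[of d e] by auto
      then have "(t * x) * (t * y) > 0" using ab by simp
      then have "(t * t) * (x * y) > 0" by (simp add: mult_ac)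
      moreover have "t * t > 0" using t t0 by simp
      ultimately show False using mult_pos_neg[of "t * t" "x * y"] xy by linarith
    qed
    then show ?thesis using t t0 by (auto simp: G_def intro!: exI[of _ t])
  qed
  obtain tg where tg: "tg > 0" "p + tg *\<^sub>R u \<in> G"
    using hit1[OF z(2,3)] unfolding u_def G_def by auto
  have segu: "p + s *\<^sub>R u \<notin> G" if "0 \<le> s" "s \<le> 1" for s
  proof -
    have "p + s *\<^sub>R u \<in> closed_segment p (p + u)"
      using that by (auto simp: closed_segment_def algebra_simps)
    then show ?thesis using seg by (auto simp: G_def u_def add.assoc)
  qed
  have tg1: "tg > 1" using segu[of tg] tg by (metis less_imp_le not_le)
  \<comment> \<open>The first point on the way to the obstacle that is not trapped.\<close>
  define I where "I = {s \<in> {1..tg}. p + s *\<^sub>R u \<notin> Z}"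
  have "I = {1..tg} \<inter> (\<lambda>s. p + s *\<^sub>R u) -` (- Z)" by (auto simp: I_def)
  moreover have "closed \<dots>" using oZ by (intro continuous_closed_preimage continuous_intros) auto
  ultimately have "closed I" by simp
  moreover have "bounded I" by (rule bounded_subset[of "{1..tg}"]) (auto simp: I_def)
  ultimately have "compact I" by (simp add: compact_eq_bounded_closed)
  moreover have tgI: "tg \<in> I" using tg tg1 ZG by (auto simp: I_def)
  ultimately obtain s0 where s0: "s0 \<in> I" "\<And>s. s \<in> I \<Longrightarrow> s0 \<le> s"
    using compact_attains_inf[of I] by auto
  have "s0 \<noteq> 1" using s0(1) zu by (auto simp: I_def)
  then have s1: "1 < s0" "s0 \<le> tg" using s0(1) by (auto simp: I_def)
  have below: "p + s *\<^sub>R u \<in> Z" if "1 \<le> s" "s < s0" for s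
    using s0(2)[of s] that s1 by (auto simp: I_def)
  define q where "q = p + s0 *\<^sub>R u"
  have qZ: "q \<notin> Z" using s0(1) by (simp add: I_def q_def)
  have "q \<in> closure Z"
  proof -
    have "((\<lambda>s. p + s *\<^sub>R u) \<longlongrightarrow> p + s0 *\<^sub>R u) (at_left s0)" by (intro tendsto_intros)
    moreover have "eventually (\<lambda>s. s \<in> {1<..<s0}) (at_left s0)" using s1 by (intro eventually_at_leftI[of 1]) auto
    then have "eventually (\<lambda>s. p + s *\<^sub>R u \<in> closure Z) (at_left s0)"
      by eventually_elim (use below closure_subset in force)
    ultimately show ?thesis unfolding q_def
      by (intro Lim_in_closed_set[of "closure Z" _ "at_left s0"]) auto
  qed
  then have qW: "q \<in> W" using cl by (auto simp: Z_def G_def)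
  then have qG: "q \<notin> G" using W by (auto simp: G_def)
  obtain v where v: "v \<noteq> 0" "avoids G q v" using qZ qW by (auto simp: Z_def trapped_def)
  have pq: "closed_segment p q \<inter> G = {}"
  proof -
    have "p + (s * s0) *\<^sub>R u \<notin> G" if "0 \<le> s" "s \<le> 1" for s
    proof -
      have "s * s0 \<le> s0" using that s1 by (simp add: mult_left_le_one_le)
      then consider "s * s0 \<le> 1" | "1 < s * s0" "s * s0 < s0" | "s * s0 = s0" by linarith
      then show ?thesis
      proof cases
        case 1 then show ?thesis using that s1 by (intro segu) auto
      next
        case 2 then show ?thesis using below[of "s * s0"] ZG by auto
      next
        case 3 show ?thesis using qG unfolding q_def 3 .
      qed
    qed
    moreover have "(1 - s) *\<^sub>R p + s *\<^sub>R q = p + (s * s0) *\<^sub>R u" for s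
      by (simp add: q_def algebra_simps)
    ultimately show ?thesis by (auto simp: closed_segment_def)
  qed
  then have pqi: "closed_segment p q \<inter> G1 = {}" "closed_segment p q \<inter> G2 = {}"
    "closed_segment q p \<inter> G1 = {}" "closed_segment q p \<inter> G2 = {}"
    by (auto simp: G_def closed_segment_commute)
  have qp: "q - p = s0 *\<^sub>R u" "p - q = (- s0) *\<^sub>R u" by (auto simp: q_def)
  have sh: "det2 (p - q) (p + x - q) = - s0 * det2 u x" for x
  proof -
    have eq: "p + x - q = x + (- s0) *\<^sub>R u" by (simp add: q_def)
    show ?thesis unfolding eq qp(2) by (simp add: det2_diff)
  qed
  have avi: "avoids G1 p d" "avoids G2 p d" "avoids G1 p e" "avoids G2 p e" "avoids G1 q v" "avoids G2 q v"
    using av v by (auto simp: G_def avoids_Un)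
  have zfree: False if "avoids G (p + u) w" "w \<noteq> 0" for w
    using zu that by (auto simp: Z_def trapped_def)
  consider "det2 u v > 0" | "det2 u v < 0" | "det2 u v = 0" by linarith
  then show False
  proof cases
    case 1
    have D: "det2 (q - p) d > 0" "det2 (q - p) v > 0" using 1 ud s1 by (auto simp: qp)
    obtain t1 where t1: "t1 > 0" "p + t1 *\<^sub>R (a *\<^sub>R d + (b + 1) *\<^sub>R e) \<in> G1" using hit1[of a "b + 1"] z by auto
    obtain t2 where t2: "t2 > 0" "p + t2 *\<^sub>R ((-1) *\<^sub>R d + 1 *\<^sub>R e) \<in> G2" using hit2[of "-1" 1] by auto
    have "a *\<^sub>R d + (b + 1) *\<^sub>R e = u + e" by (simp add: u_def algebra_simps)
    then have n1: "det2 (q - p) (p + t1 *\<^sub>R (a *\<^sub>R d + (b + 1) *\<^sub>R e) - p) < 0"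
      using t1 s1 ue by (simp add: qp mult_pos_neg)
    have n2: "det2 (q - p) (p + t2 *\<^sub>R ((-1) *\<^sub>R d + 1 *\<^sub>R e) - p) < 0"
    proof -
      have "det2 u e - det2 u d < 0" using ue ud by simp
      then have "s0 * (t2 * (det2 u e - det2 u d)) < 0" using s1 t2 by (simp add: mult_pos_neg)
      then show ?thesis by (simp add: qp det2_diff algebra_simps)
    qed
    \<comment> \<open>The parameter of the trapped point on the segment from \<open>p\<close> to \<open>q\<close>.\<close>
    define s where "s = 1 / s0"
    have s: "0 \<le> s" "s \<le> 1" "s \<noteq> 1" using s1 by (auto simp: s_def)
    define w where "w = ((1 - s) / det2 (q - p) d) *\<^sub>R d + (s / det2 (q - p) v) *\<^sub>R v"
    have "avoids G1 (p + s *\<^sub>R (q - p)) w" unfolding w_def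
      by (rule sweep[OF G(1) D avi(1,5) pqi(1) t1(2) disjI1[OF n1] s(1,2)])
    moreover have "avoids G2 (p + s *\<^sub>R (q - p)) w" unfolding w_def
      by (rule sweep[OF G(2) D avi(2,6) pqi(2) t2(2) disjI1[OF n2] s(1,2)])
    moreover have "p + s *\<^sub>R (q - p) = p + u" using s1 by (simp add: qp s_def)
    moreover have "det2 (q - p) w = 1" using D by (simp add: w_def)
    then have "w \<noteq> 0" by auto
    ultimately show False using zfree[of w] by (simp add: G_def avoids_Un)
  next
    case 2
    have D: "det2 (p - q) v > 0" "det2 (p - q) e > 0" using 2 ue s1 by (auto simp: qp mult_less_0_iff)
    obtain t1 where t1: "t1 > 0" "p + t1 *\<^sub>R ((a + 1) *\<^sub>R d + b *\<^sub>R e) \<in> G1" using hit1[of "a + 1" b] z by auto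
    obtain t2 where t2: "t2 > 0" "p + t2 *\<^sub>R (1 *\<^sub>R d + (-1) *\<^sub>R e) \<in> G2" using hit2[of 1 "-1"] by auto
    have "(a + 1) *\<^sub>R d + b *\<^sub>R e = u + d" by (simp add: u_def algebra_simps)
    then have n1: "det2 (p - q) (p + t1 *\<^sub>R ((a + 1) *\<^sub>R d + b *\<^sub>R e) - q) < 0"
      unfolding sh using t1 s1 ud by simp
    have n2: "det2 (p - q) (p + t2 *\<^sub>R (1 *\<^sub>R d + (-1) *\<^sub>R e) - q) < 0"
    proof -
      have "det2 u d - det2 u e > 0" using ue ud by simp
      then have "s0 * (t2 * (det2 u d - det2 u e)) > 0" using s1 t2 by simp
      then show ?thesis unfolding sh by (simp add: det2_diff algebra_simps)
    qed
    define s where "s = 1 - 1 / s0"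
    have s: "0 \<le> s" "s \<le> 1" using s1 by (auto simp: s_def)
    define w where "w = ((1 - s) / det2 (p - q) v) *\<^sub>R v + (s / det2 (p - q) e) *\<^sub>R e"
    have "avoids G1 (q + s *\<^sub>R (p - q)) w" unfolding w_def
      by (rule sweep[OF G(1) D avi(5,3) pqi(3) t1(2) disjI1[OF n1] s])
    moreover have "avoids G2 (q + s *\<^sub>R (p - q)) w" unfolding w_def
      by (rule sweep[OF G(2) D avi(6,4) pqi(4) t2(2) disjI1[OF n2] s])
    moreover have "q + s *\<^sub>R (p - q) = p + u" using s1 unfolding qp(2) by (simp add: q_def s_def algebra_simps)
    moreover have "det2 (p - q) w = 1" using D by (simp add: w_def)
    then have "w \<noteq> 0" by auto
    ultimately show False using zfree[of w] by (simp add: G_def avoids_Un)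
  next
    case 3
    then obtain l where l: "v = l *\<^sub>R u" using det2_eq_0[OF 3 u0] by blast
    then have l0: "l \<noteq> 0" using v by auto
    show False
    proof (cases "l > 0")
      case True
      \<comment> \<open>The ray continues the walk and runs into the obstacle.\<close>
      have "q + ((tg - s0) / l) *\<^sub>R v \<notin> G" using True s1 by (intro avoidsD[OF v(2)]) auto
      moreover have "((tg - s0) / l) *\<^sub>R v = (tg - s0) *\<^sub>R u" using True by (simp add: l)
      then have "q + ((tg - s0) / l) *\<^sub>R v = p + tg *\<^sub>R u" by (simp add: q_def algebra_simps)
      ultimately show False using tg by simp
    next
      case False
      then have l1: "l < 0" using l0 by simp
      \<comment> \<open>The ray turns back through \<open>p\<close>, which gives \<open>p\<close> a free direction besides \<open>d\<close> and \<open>e\<close>.\<close>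
      have "avoids G p (- u)" unfolding avoids_def
      proof (intro allI impI)
        fix t :: real assume t: "t \<ge> 0"
        have "q + ((- t - s0) / l) *\<^sub>R v \<notin> G" using l1 s1 t by (intro avoidsD[OF v(2)]) (auto intro: divide_nonpos_nonpos)
        moreover have "((- t - s0) / l) *\<^sub>R v = (- t - s0) *\<^sub>R u" using l1 by (simp add: l)
        then have "q + ((- t - s0) / l) *\<^sub>R v = p + t *\<^sub>R (- u)" by (simp add: q_def algebra_simps)
        ultimately show "p + t *\<^sub>R (- u) \<notin> G" by simp
      qed
      then obtain c where c: "c > 0" "- u = c *\<^sub>R d \<or> - u = c *\<^sub>R e" using only[of "- u"] u0 by (auto simp: G_def)
      have "det2 d (- u) > 0" "det2 e (- u) < 0"
        using ud ue det2_commute[of d u] det2_commute[of e u] by auto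
      then have "det2 d (- u) \<noteq> 0" "det2 e (- u) \<noteq> 0" by auto
      then show False using c(2) by (metis det2_simps(1,9) mult_zero_right)
    qed
  qed
qed

section \<open>Two connected obstacles trap no point\<close>

lemma det2_inner: "det2 d y = (\<i> * d) \<bullet> y"
  by (simp add: det2_def inner_complex_def)

lemma det2_coords:
  assumes "det2 d e \<noteq> 0" "x *\<^sub>R d + y *\<^sub>R e = x' *\<^sub>R d + y' *\<^sub>R e"
  shows "x = x'" "y = y'"
  using arg_cong[OF assms(2), of "\<lambda>v. det2 v e"] arg_cong[OF assms(2), of "det2 d"] assms(1) by auto

text \<open>The intersection of the two open half-planes is one of the four sectors between the lines along \<open>d\<close> and \<open>e\<close>.
As the half-plane of \<open>b\<close> contains \<open>- d\<close>, that sector has directions close to \<open>- d\<close>, and \<open>n\<close> decreases along these.\<close>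
lemma descent_direction:
  fixes d e :: complex
  assumes n: "n \<bullet> d > 0" "n \<bullet> e > 0" and nrm: "norm d = 1" "norm e = 1"
    and ab: "a \<bullet> d = 0" "b \<bullet> e = 0" "a \<bullet> e \<noteq> 0" "b \<bullet> d < 0" and r: "r > 0"
  obtains y where "norm y < r" "a \<bullet> y > 0" "b \<bullet> y > 0" "n \<bullet> y < 0"
proof -
  define k where "k = min 1 ((n \<bullet> d) / (2 * (n \<bullet> e)))"
  have k: "k > 0" "k \<le> 1" "k * (n \<bullet> e) \<le> (n \<bullet> d) / 2"
    using n by (auto simp: k_def field_simps min_def)
  define s where "s = sgn (a \<bullet> e)"
  have s: "\<bar>s\<bar> = 1" "s * (a \<bullet> e) > 0" using ab(3) by (auto simp: s_def abs_sgn_eq sgn_if)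
  define y where "y = (r / 4) *\<^sub>R ((- 1) *\<^sub>R d + (k * s) *\<^sub>R e)"
  have "norm ((- 1) *\<^sub>R d + (k * s) *\<^sub>R e) \<le> 1 + k"
    by (rule order_trans[OF norm_triangle_ineq]) (use nrm s k in \<open>simp add: abs_mult\<close>)
  then have "(r / 4) * norm ((- 1) *\<^sub>R d + (k * s) *\<^sub>R e) \<le> (r / 4) * 2"
    using k r by (intro mult_left_mono) auto
  then have 1: "norm y < r" unfolding y_def using r by simp
  have "a \<bullet> y = (r / 4) * (k * (s * (a \<bullet> e)))" using ab by (simp add: y_def inner_add_right inner_diff_right)
  also have "\<dots> > 0" by (rule mult_pos_pos, use r in simp, rule mult_pos_pos[OF k(1) s(2)])
  finally have 2: "a \<bullet> y > 0" .
  have "b \<bullet> y = (r / 4) * (- (b \<bullet> d))" using ab by (simp add: y_def inner_add_right inner_diff_right)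
  then have 3: "b \<bullet> y > 0" using r ab by (simp add: mult_pos_neg)
  have "k * s * (n \<bullet> e) \<le> k * (n \<bullet> e)" using s k n by (intro mult_right_mono) auto
  then have "- (n \<bullet> d) + k * s * (n \<bullet> e) < 0" using k(3) n(1) by linarith
  note neg = this
  have "n \<bullet> y = (r / 4) * (- (n \<bullet> d) + k * s * (n \<bullet> e))"
    by (simp add: y_def inner_add_right inner_diff_right)
  also have "\<dots> < 0" by (rule mult_pos_neg[OF _ neg]) (use r in simp)
  finally have 4: "n \<bullet> y < 0" .
  show thesis by (rule that[OF 1 2 3 4])
qed

text \<open>The situation to be refuted.  Points of \<open>W\<close> are trapped if all rays from them hit \<open>G1 \<union> G2\<close>, and the trapped
points do not accumulate at the boundary of \<open>W\<close>.\<close>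
locale two_obstacles =
  fixes G1 G2 W :: "complex set"
  assumes opn: "open G1" "open G2" and conn: "connected G1" "connected G2"
    and nonempty: "G1 \<noteq> {}" "G2 \<noteq> {}" and bdd: "bounded G1" "bounded G2"
    and W: "open W" "W \<inter> (G1 \<union> G2) = {}"
    and cl: "closure (trapped (G1 \<union> G2) W) \<subseteq> W" and some_trapped: "trapped (G1 \<union> G2) W \<noteq> {}"
begin

abbreviation "G \<equiv> G1 \<union> G2"
abbreviation "Z \<equiv> trapped G W"

lemma open_Z: "open Z"
  by (intro open_trapped open_Un opn W)

lemma compact_hull: "compact (convex hull (closure Z))"
proof -
  have "bounded G" using bdd by simp
  then have "compact (closure Z)"
    using bounded_trapped[of G W] by (simp only: compact_closure)
  then show ?thesis by (rule compact_convex_hull)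
qed

lemma extreme_point_position:
  assumes "p extreme_point_of (convex hull (closure Z))"
  shows "p \<in> closure Z" "p \<notin> Z" "p \<in> W"
proof -
  show 1: "p \<in> closure Z" using assms by (rule extreme_point_of_convex_hull)
  then show "p \<in> W" using cl by auto
  show "p \<notin> Z"
  proof
    assume "p \<in> Z"
    then obtain e where e: "e > 0" "ball p e \<subseteq> Z" using open_Z openE by blast
    have "p + of_real (e / 2) \<in> ball p e" "p - of_real (e / 2) \<in> ball p e"
      using e(1) by (auto simp: dist_norm simp del: of_real_divide)
    then have "p + of_real (e / 2) \<in> closure Z" "p - of_real (e / 2) \<in> closure Z"
      using e(2) closure_subset[of Z] by blast+
    then have "of_real (e / 2) = (0 :: complex)" by (rule not_extreme_midpoint[OF assms])
    then show False using e by simp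
  qed
qed

text \<open>What the trapped set looks like at an extreme point \<open>p\<close> of the hull of its closure: two free directions,
and near \<open>p\<close> all points of an intersection of two open half-planes bounded by the lines along these
directions.\<close>
definition corner where
  "corner p d e a b r \<longleftrightarrow> norm d = 1 \<and> norm e = 1 \<and> d \<noteq> e \<and> avoids G p d \<and> avoids G p e \<and>
     (\<forall>v. v \<noteq> 0 \<longrightarrow> avoids G p v \<longrightarrow> (\<exists>c>0. v = c *\<^sub>R d \<or> v = c *\<^sub>R e)) \<and>
     a \<noteq> 0 \<and> b \<noteq> 0 \<and> a \<bullet> d = 0 \<and> b \<bullet> e = 0 \<and> r > 0 \<and> ball p r \<subseteq> W \<and>
     (\<forall>q\<in>ball p r. a \<bullet> (q - p) > 0 \<longrightarrow> b \<bullet> (q - p) > 0 \<longrightarrow> q \<in> Z)"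

text \<open>At most two directions are free at \<open>p\<close>, since an arc of free directions would free nearby trapped points.
If only one were free, an open half-disc at \<open>p\<close> would be trapped, and \<open>p\<close> would be the midpoint of a diameter
in the closure of the trapped set.\<close>
lemma extreme_point_corner:
  assumes p: "p extreme_point_of (convex hull (closure Z))"
  obtains d e a b r where "corner p d e a b r"
proof -
  note pos = extreme_point_position[OF p]
  have oG: "open G" using opn by (rule open_Un)
  obtain \<rho> where \<rho>: "\<rho> > 0" "ball p \<rho> \<subseteq> W" using pos(3) W(1) openE by blast
  have \<rho>G: "ball p \<rho> \<inter> G = {}" using \<rho> W by blast
  have acc: "\<exists>z\<in>ball p \<epsilon>. z \<in> Z" if "\<epsilon> > 0" for \<epsilon>
    using pos(1) that unfolding closure_approachable by (metis dist_commute mem_ball)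
  have acc': "\<exists>z\<in>ball p \<epsilon>. \<forall>v. v \<noteq> 0 \<longrightarrow> \<not> avoids G z v" if "\<epsilon> > 0" for \<epsilon>
    using acc[OF that] by (auto simp: trapped_def)
  have unit: "norm ((1 / norm v) *\<^sub>R v) = 1" "avoids G x ((1 / norm v) *\<^sub>R v)"
    if "v \<noteq> 0" "avoids G x v" for x v :: complex
    using that avoids_scale[OF that(2), of "1 / norm v"] by auto
  obtain v0 where "v0 \<noteq> 0" "avoids G p v0" using pos by (auto simp: trapped_def)
  note d = unit[OF this]
  define d where "d = (1 / norm v0) *\<^sub>R v0"
  have d: "norm d = 1" "avoids G p d" using d by (auto simp: d_def)
  have no_free_arc: "\<exists>w\<in>ball u \<epsilon>. \<not> avoids G p w" if u: "norm u = 1" "\<epsilon> > 0" for u \<epsilon>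
  proof (rule ccontr)
    assume "\<not> ?thesis"
    then have fr: "\<And>w. w \<in> ball u \<epsilon> \<Longrightarrow> avoids G p w" by blast
    obtain s where "s > 0" "\<And>q. q \<in> ball p s \<Longrightarrow> avoids G q u"
      using free_arc_stable[OF \<rho>(1) \<rho>G u(2,1) fr] by blast
    moreover obtain z where "z \<in> ball p s" "\<forall>v. v \<noteq> 0 \<longrightarrow> \<not> avoids G z v" using acc'[OF \<open>s > 0\<close>] by blast
    moreover have "u \<noteq> 0" using u by auto
    ultimately show False by blast
  qed
  obtain e where e: "norm e = 1" "avoids G p e"
    and de: "\<And>v. norm v = 1 \<Longrightarrow> avoids G p v \<Longrightarrow> v = d \<or> v = e"
    using at_most_two_free_directions[OF conn d no_free_arc] by blast
  have half_plane: "\<exists>a \<eta>. \<eta> > 0 \<and> a \<noteq> 0 \<and> a \<bullet> f = 0 \<and>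
      (\<forall>q v. q \<in> ball p \<eta> \<longrightarrow> v \<in> ball f \<eta> \<longrightarrow> avoids G q v \<longrightarrow> a \<bullet> (q - p) \<le> 0)"
    if f: "norm f = 1" "avoids G p f" for f
  proof (rule local_half_plane[OF conn opn nonempty \<rho>(1) \<rho>G f acc'])
    fix a \<eta> assume "\<eta> > 0" "a \<noteq> 0" "a \<bullet> f = 0"
      "\<And>q v. q \<in> ball p \<eta> \<Longrightarrow> v \<in> ball f \<eta> \<Longrightarrow> avoids G q v \<Longrightarrow> a \<bullet> (q - p) \<le> 0"
    then show ?thesis by (intro exI[of _ a] exI[of _ \<eta>]) simp
  qed
  obtain a \<eta>1 where a: "\<eta>1 > 0" "a \<noteq> 0" "a \<bullet> d = 0"
    "\<And>q v. q \<in> ball p \<eta>1 \<Longrightarrow> v \<in> ball d \<eta>1 \<Longrightarrow> avoids G q v \<Longrightarrow> a \<bullet> (q - p) \<le> 0"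
    using half_plane[OF d] by metis
  obtain b \<eta>2 where b: "\<eta>2 > 0" "b \<noteq> 0" "b \<bullet> e = 0"
    "\<And>q v. q \<in> ball p \<eta>2 \<Longrightarrow> v \<in> ball e \<eta>2 \<Longrightarrow> avoids G q v \<Longrightarrow> b \<bullet> (q - p) \<le> 0"
    using half_plane[OF e] by metis
  have "min \<eta>1 \<eta>2 > 0" using a b by simp
  then obtain r1 where r1: "r1 > 0" "\<And>q v. q \<in> ball p r1 \<Longrightarrow> norm v = 1 \<Longrightarrow> avoids G q v \<Longrightarrow>
     \<exists>f. norm f = 1 \<and> avoids G p f \<and> v \<in> ball f (min \<eta>1 \<eta>2)"
    using free_directions_near[OF oG, of "min \<eta>1 \<eta>2" p] by blast
  define r where "r = min (min r1 \<rho>) (min \<eta>1 \<eta>2)"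
  have r: "r > 0" "r \<le> r1" "r \<le> \<rho>" "r \<le> \<eta>1" "r \<le> \<eta>2" using r1 \<rho> a b by (auto simp: r_def)
  have inZ: "q \<in> Z" if q: "q \<in> ball p r"
    and no: "\<And>f v. f = d \<or> f = e \<Longrightarrow> v \<in> ball f (min \<eta>1 \<eta>2) \<Longrightarrow> \<not> avoids G q v" for q
  proof -
    have "\<not> avoids G q v" if v: "v \<noteq> 0" for v
    proof
      assume "avoids G q v"
      note v' = unit[OF v this]
      have "q \<in> ball p r1" using q r by auto
      then obtain f where "norm f = 1" "avoids G p f" "(1 / norm v) *\<^sub>R v \<in> ball f (min \<eta>1 \<eta>2)"
        using r1(2)[OF _ v'] by blast
      then show False using no[of f] de[of f] v'(2) by blast
    qed
    moreover have "q \<in> W" using q r \<rho> by auto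
    ultimately show ?thesis by (auto simp: trapped_def)
  qed
  have noa: "\<not> avoids G q v" if "q \<in> ball p r" "a \<bullet> (q - p) > 0" "v \<in> ball d \<eta>1" for q v
    using a(4)[of q v] that r by auto
  have nob: "\<not> avoids G q v" if "q \<in> ball p r" "b \<bullet> (q - p) > 0" "v \<in> ball e \<eta>2" for q v
    using b(4)[of q v] that r by auto
  have "d \<noteq> e"
  proof
    assume eq: "d = e"
    have half: "q \<in> Z" if "q \<in> ball p r" "a \<bullet> (q - p) > 0" for q
      by (rule inZ[OF that(1)]) (use noa[OF that] eq in auto)
    have cl: "p + t *\<^sub>R d \<in> closure Z" if t: "\<bar>t\<bar> = r / 2" for t
      unfolding closure_approachable
    proof (intro allI impI)
      fix \<epsilon> :: real assume \<epsilon>: "\<epsilon> > 0"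
      define k where "k = min (\<epsilon> / 2) (r / 4) / norm a"
      have k: "k > 0" "k * norm a < \<epsilon>" "k * norm a < r / 2" using \<epsilon> r a by (auto simp: k_def)
      define y where "y = p + t *\<^sub>R d + k *\<^sub>R a"
      have "norm (t *\<^sub>R d + k *\<^sub>R a) < r"
        using norm_triangle_ineq[of "t *\<^sub>R d" "k *\<^sub>R a"] t k d by simp
      then have "y \<in> ball p r"
        by (simp only: y_def mem_ball dist_norm norm_minus_commute[of p] add.assoc add_diff_cancel_left')
      moreover have "a \<bullet> (y - p) > 0" using a k by (simp add: y_def inner_add_right)
      ultimately have "y \<in> Z" by (rule half)
      moreover have "dist y (p + t *\<^sub>R d) < \<epsilon>" using k by (simp add: y_def dist_norm)
      ultimately show "\<exists>y\<in>Z. dist y (p + t *\<^sub>R d) < \<epsilon>" by blast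
    qed
    have "(r / 2) *\<^sub>R d = 0"
      by (rule not_extreme_midpoint[OF p]) (use cl[of "r / 2"] cl[of "- r / 2"] r in auto)
    then show False using r d by auto
  qed
  moreover have "\<exists>c>0. v = c *\<^sub>R d \<or> v = c *\<^sub>R e" if v: "v \<noteq> 0" "avoids G p v" for v
  proof -
    have "(1 / norm v) *\<^sub>R v = d \<or> (1 / norm v) *\<^sub>R v = e" using de[OF unit[OF v]] .
    moreover have "v = norm v *\<^sub>R ((1 / norm v) *\<^sub>R v)" using v by simp
    ultimately show ?thesis using v by (metis zero_less_norm_iff)
  qed
  moreover have "ball p r \<subseteq> W" using r \<rho> by auto
  moreover have "q \<in> Z" if "q \<in> ball p r" "a \<bullet> (q - p) > 0" "b \<bullet> (q - p) > 0" for q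
    by (rule inZ[OF that(1)]) (use noa[OF that(1,2)] nob[OF that(1,3)] in auto)
  ultimately have "corner p d e a b r" unfolding corner_def using d e a b r by blast
  then show thesis by (rule that)
qed

lemma hit:
  assumes "corner p d e a b r" "det2 d v \<noteq> 0" "det2 e v \<noteq> 0"
  shows "\<exists>t\<ge>0. p + t *\<^sub>R v \<in> G"
proof -
  have "v \<noteq> 0" "\<And>c. v \<noteq> c *\<^sub>R d" "\<And>c. v \<noteq> c *\<^sub>R e" using assms(2,3) by auto
  then have "\<not> avoids G p v" using assms(1) unfolding corner_def by blast
  then show ?thesis by (auto simp: avoids_def)
qed

text \<open>The two directions \<open>d + e\<close> and \<open>- (d + e)\<close>, one in the convex sector and one outside, are both hit;
hence the obstacles lie in different sectors.\<close>
lemma sector_split: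
  assumes c: "corner p d e a b r" and X: "det2 d e \<noteq> 0"
  shows "((\<forall>y\<in>G1. \<exists>x>0. \<exists>x'>0. y = p + x *\<^sub>R d + x' *\<^sub>R e) \<and>
          (\<forall>x\<ge>0. \<forall>x'\<ge>0. p + x *\<^sub>R d + x' *\<^sub>R e \<notin> G2)) \<or>
         ((\<forall>y\<in>G2. \<exists>x>0. \<exists>x'>0. y = p + x *\<^sub>R d + x' *\<^sub>R e) \<and>
          (\<forall>x\<ge>0. \<forall>x'\<ge>0. p + x *\<^sub>R d + x' *\<^sub>R e \<notin> G1))"
proof -
  have av: "avoids G1 p d" "avoids G1 p e" "avoids G2 p d" "avoids G2 p e"
    using c by (auto simp: corner_def avoids_Un)
  have X': "det2 e d \<noteq> 0" using X det2_commute[of d e] by simp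
  obtain t where t: "t \<ge> 0" "p + t *\<^sub>R (d + e) \<in> G" using hit[OF c, of "d + e"] X X' by auto
  obtain t' where t': "t' \<ge> 0" "p + t' *\<^sub>R (- (d + e)) \<in> G" using hit[OF c, of "- (d + e)"] X X' by (auto simp: det2_diff)
  have "\<not> (\<forall>x\<ge>0. \<forall>x'\<ge>0. p + x *\<^sub>R d + x' *\<^sub>R e \<notin> G1) \<or> \<not> (\<forall>x\<ge>0. \<forall>x'\<ge>0. p + x *\<^sub>R d + x' *\<^sub>R e \<notin> G2)"
    using t by (auto simp: scaleR_add_right add.assoc)
  moreover have "\<nexists>x x'. x > 0 \<and> x' > 0 \<and> p + t' *\<^sub>R (- (d + e)) = p + x *\<^sub>R d + x' *\<^sub>R e"
  proof clarify
    fix x x' :: real assume x: "x > 0" "x' > 0" "p + t' *\<^sub>R (- (d + e)) = p + x *\<^sub>R d + x' *\<^sub>R e"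
    then have eq: "t' *\<^sub>R (- (d + e)) = x *\<^sub>R d + x' *\<^sub>R e" by (simp only: add.assoc add_left_cancel)
    have "- t' * det2 d e = x * det2 d e" using arg_cong[OF eq, of "\<lambda>v. det2 v e"] by (simp add: det2_diff)
    then have "- t' = x" using X by (metis mult_right_cancel)
    then show False using x t' by simp
  qed
  then have "\<not> ((\<forall>y\<in>G1. \<exists>x>0. \<exists>x'>0. y = p + x *\<^sub>R d + x' *\<^sub>R e) \<and>
     (\<forall>y\<in>G2. \<exists>x>0. \<exists>x'>0. y = p + x *\<^sub>R d + x' *\<^sub>R e))" using t'(2) by blast
  ultimately show ?thesis using sector[OF conn(1) X av(1,2)] sector[OF conn(2) X av(3,4)] by blast
qed

lemma opposite_split:
  assumes c: "corner p d e a b r" and X: "det2 d e = 0"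
  obtains s where "e = - d" "s \<noteq> 0" "\<And>y. y \<in> G1 \<Longrightarrow> s * det2 d (y - p) > 0" "\<And>y. y \<in> G2 \<Longrightarrow> s * det2 d (y - p) < 0"
proof -
  have n: "norm d = 1" "norm e = 1" "d \<noteq> e" and av: "avoids G p d" "avoids G p e" using c by (auto simp: corner_def)
  then have d0: "d \<noteq> 0" by auto
  obtain l where l: "e = l *\<^sub>R d" using det2_eq_0[OF X d0] by blast
  then have "\<bar>l\<bar> = 1" using n by simp
  moreover have "l \<noteq> 1" using l n by auto
  ultimately have "l = - 1" by simp
  then have ed: "e = - d" using l by simp
  have one: "(\<forall>y\<in>G1. det2 d (y - p) > 0) \<or> (\<forall>y\<in>G1. det2 d (y - p) < 0)"
    "(\<forall>y\<in>G2. det2 d (y - p) > 0) \<or> (\<forall>y\<in>G2. det2 d (y - p) < 0)"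
    by (rule one_side_of_line[OF conn(1) d0] one_side_of_line[OF conn(2) d0]; use av ed in \<open>simp add: avoids_Un\<close>)+
  have di: "det2 d (\<i> * d) = 1" using n(1) by (simp add: det2_def cmod_def power2_eq_square)
  have e1: "\<exists>y\<in>G. det2 d (y - p) \<ge> 0"
  proof -
    obtain t where "t \<ge> 0" "p + t *\<^sub>R (\<i> * d) \<in> G" using hit[OF c, of "\<i> * d"] di ed by auto
    then show ?thesis using di by (intro bexI[of _ "p + t *\<^sub>R (\<i> * d)"]) auto
  qed
  have e2: "\<exists>y\<in>G. det2 d (y - p) \<le> 0"
  proof -
    obtain t where "t \<ge> 0" "p + t *\<^sub>R (- (\<i> * d)) \<in> G" using hit[OF c, of "- (\<i> * d)"] di ed by auto
    then show ?thesis using di by (intro bexI[of _ "p + t *\<^sub>R (- (\<i> * d))"]) auto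
  qed
  have "((\<forall>y\<in>G1. det2 d (y - p) > 0) \<and> (\<forall>y\<in>G2. det2 d (y - p) < 0)) \<or>
    ((\<forall>y\<in>G1. det2 d (y - p) < 0) \<and> (\<forall>y\<in>G2. det2 d (y - p) > 0))"
    using one e1 e2 by (metis Un_iff not_le)
  then show thesis
  proof
    assume "(\<forall>y\<in>G1. det2 d (y - p) > 0) \<and> (\<forall>y\<in>G2. det2 d (y - p) < 0)"
    then show thesis by (intro that[of 1] ed) auto
  next
    assume "(\<forall>y\<in>G1. det2 d (y - p) < 0) \<and> (\<forall>y\<in>G2. det2 d (y - p) > 0)"
    then show thesis by (intro that[of "- 1"] ed) auto
  qed
qed

text \<open>If the trapped set leaves the closed hull of \<open>G1\<close>, separate by a linear functional \<open>n\<close> and take an extreme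
point \<open>p\<close> that minimises \<open>n\<close>.  All directions that hit \<open>G1\<close> increase \<open>n\<close>, even in the limit.  Hence \<open>G1\<close> lies in the
convex sector of \<open>d\<close> and \<open>e\<close>, and \<open>n\<close> increases along both.  The trapped points near \<open>p\<close> then either reach lower
values of \<open>n\<close> or lie in the sector of \<open>G1\<close>; both are impossible.\<close>
lemma Z_subset_hull: "Z \<subseteq> closure (convex hull G1)"
proof (rule ccontr)
  assume "\<not> ?thesis"
  then obtain z0 where z0: "z0 \<in> Z" "z0 \<notin> closure (convex hull G1)" by blast
  obtain n m0 where n: "n \<bullet> z0 < m0" "\<And>x. x \<in> closure (convex hull G1) \<Longrightarrow> n \<bullet> x > m0"
    using separating_hyperplane_closed_point[of "closure (convex hull G1)" z0] z0
    by (auto simp: convex_closure convex_convex_hull)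
  define H where "H = convex hull (closure Z)"
  have ZH: "Z \<subseteq> H" "closure Z \<subseteq> H" unfolding H_def using closure_subset hull_subset by (metis subset_trans)+
  have H: "compact H" "convex H" "H \<noteq> {}" using compact_hull z0 ZH by (auto simp: H_def)
  have "continuous_on H (\<lambda>x. n \<bullet> x)" by (intro continuous_intros)
  from continuous_attains_inf[OF H(1,3) this] obtain h where h: "h \<in> H" "\<And>x. x \<in> H \<Longrightarrow> n \<bullet> h \<le> n \<bullet> x"
    by blast
  \<comment> \<open>An extreme point of the face on which \<open>n\<close> is minimal is an extreme point of the hull.\<close>
  define F where "F = H \<inter> {x. n \<bullet> x = n \<bullet> h}"
  have face: "F face_of H" unfolding F_def by (rule face_of_Int_supporting_hyperplane_ge[OF H(2) h(2)])
  have "compact F" "convex F" "F \<noteq> {}"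
    using face_of_imp_compact[OF H(2,1) face] face_of_imp_convex[OF face] h(1) by (auto simp: F_def)
  then obtain p where "p extreme_point_of F" using extreme_point_exists_convex by blast
  then have p: "p extreme_point_of (convex hull (closure Z))" "p \<in> F"
    using extreme_point_of_face[OF face] by (auto simp: H_def)
  have pmin: "n \<bullet> p \<le> n \<bullet> z" if "z \<in> Z" for z
    using p(2) h(2)[of z] ZH that by (auto simp: F_def)
  define m where "m = m0 - n \<bullet> p"
  have m: "m > 0" using n(1) pmin[OF z0(1)] by (simp add: m_def)
  have nG: "n \<bullet> (y - p) \<ge> m" if "y \<in> G1" for y
  proof -
    have "y \<in> closure (convex hull G1)" using that closure_subset hull_subset by (metis subsetD)
    then show ?thesis using n(2)[of y] by (simp add: m_def inner_diff_right)
  qed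
  have npos: "n \<bullet> v > 0" if "t \<ge> 0" "p + t *\<^sub>R v \<in> G1" for t v
  proof -
    have "t * (n \<bullet> v) \<ge> m" using nG[OF that(2)] by simp
    then show ?thesis using m that(1) by (metis less_le_trans zero_less_mult_pos order_le_less mult_zero_left less_irrefl)
  qed
  obtain R where R: "G1 \<subseteq> ball p R" using bdd(1) bounded_subset_ballD by blast
  obtain d e a b r where c: "corner p d e a b r" using extreme_point_corner[OF p(1)] .
  then have nrm: "norm d = 1" "norm e = 1" and ab: "a \<noteq> 0" "b \<noteq> 0" "a \<bullet> d = 0" "b \<bullet> e = 0"
    and r: "r > 0" "ball p r \<subseteq> W" and av: "avoids G p d" "avoids G p e"
    and only: "\<And>v. v \<noteq> 0 \<Longrightarrow> avoids G p v \<Longrightarrow> \<exists>c>0. v = c *\<^sub>R d \<or> v = c *\<^sub>R e"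
    and inZ: "\<And>q. q \<in> ball p r \<Longrightarrow> a \<bullet> (q - p) > 0 \<Longrightarrow> b \<bullet> (q - p) > 0 \<Longrightarrow> q \<in> Z"
    by (auto simp: corner_def)
  have X0: "det2 d e \<noteq> 0"
  proof
    assume X: "det2 d e = 0"
    obtain s where s: "e = - d" "s \<noteq> 0" and G1: "\<And>y. y \<in> G1 \<Longrightarrow> s * det2 d (y - p) > 0"
      and G2: "\<And>y. y \<in> G2 \<Longrightarrow> s * det2 d (y - p) < 0" using opposite_split[OF c X] by blast
    have di: "det2 d (\<i> * d) = 1" using nrm(1) by (simp add: det2_def cmod_def power2_eq_square)
    define w where "w = sgn s *\<^sub>R (\<i> * d)"
    have w: "norm w = 1" "det2 d w = sgn s" using s nrm di by (auto simp: w_def norm_mult)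
    have hits: "\<exists>t\<ge>0. p + t *\<^sub>R (x *\<^sub>R d + k *\<^sub>R w) \<in> G1" if k: "k > 0" for x k
    proof -
      obtain t where t: "t \<ge> 0" "p + t *\<^sub>R (x *\<^sub>R d + k *\<^sub>R w) \<in> G"
        using hit[OF c, of "x *\<^sub>R d + k *\<^sub>R w"] w s k by (auto simp: sgn_zero_iff)
      have "s * det2 d (p + t *\<^sub>R (x *\<^sub>R d + k *\<^sub>R w) - p) = t * (k * (s * sgn s))" using w by simp
      also have "s * sgn s = \<bar>s\<bar>" by (simp add: abs_sgn)
      also have "t * (k * \<bar>s\<bar>) \<ge> 0" using t k by simp
      finally show ?thesis using G2 t by (metis Un_iff not_le)
    qed
    have "n \<bullet> d > 0"
      by (rule limit_direction_positive[OF R m nG nrm(1) w(1)]) (use hits[of _ 1] in auto)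
    moreover have "n \<bullet> (- d) > 0"
      by (rule limit_direction_positive[OF R m nG _ w(1)]) (use nrm hits[of _ "-1"] in auto)
    ultimately show False by simp
  qed
  have X0': "det2 e d \<noteq> 0" using X0 det2_commute[of d e] by simp
  show False using sector_split[OF c X0]
  proof (elim disjE conjE)
    assume G2: "\<forall>y\<in>G2. \<exists>x>0. \<exists>x'>0. y = p + x *\<^sub>R d + x' *\<^sub>R e"
    have hits: "n \<bullet> (x *\<^sub>R d + x' *\<^sub>R e) > 0" if x: "x \<noteq> 0" "x' \<noteq> 0" "x < 0 \<or> x' < 0" for x x'
    proof -
      obtain t where t: "t \<ge> 0" "p + t *\<^sub>R (x *\<^sub>R d + x' *\<^sub>R e) \<in> G"
        using hit[OF c, of "x *\<^sub>R d + x' *\<^sub>R e"] x X0 X0' by auto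
      have "p + t *\<^sub>R (x *\<^sub>R d + x' *\<^sub>R e) \<notin> G2"
      proof
        assume "p + t *\<^sub>R (x *\<^sub>R d + x' *\<^sub>R e) \<in> G2"
        then obtain y y' where y: "y > 0" "y' > 0" "p + t *\<^sub>R (x *\<^sub>R d + x' *\<^sub>R e) = p + y *\<^sub>R d + y' *\<^sub>R e"
          using G2 by blast
        then have "(t * x) *\<^sub>R d + (t * x') *\<^sub>R e = y *\<^sub>R d + y' *\<^sub>R e" by (simp add: scaleR_add_right add.assoc)
        then have "t * x = y" "t * x' = y'" by (rule det2_coords[OF X0])+
        then show False using y x t by (auto simp: zero_less_mult_iff)
      qed
      then show ?thesis using t npos by blast
    qed
    \<comment> \<open>A positive combination of these three directions vanishes.\<close>
    have "n \<bullet> ((-1) *\<^sub>R d + (-1) *\<^sub>R e) > 0" "n \<bullet> (1 *\<^sub>R d + (- (1/2)) *\<^sub>R e) > 0" "n \<bullet> ((- (1/2)) *\<^sub>R d + 1 *\<^sub>R e) > 0"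
      by (rule hits; simp)+
    then show False by (simp add: inner_add_right inner_diff_right)
  next
    assume G1: "\<forall>y\<in>G1. \<exists>x>0. \<exists>x'>0. y = p + x *\<^sub>R d + x' *\<^sub>R e"
      and G2: "\<forall>x\<ge>0. \<forall>x'\<ge>0. p + x *\<^sub>R d + x' *\<^sub>R e \<notin> G2"
    have hits: "\<exists>t\<ge>0. p + t *\<^sub>R (x *\<^sub>R d + x' *\<^sub>R e) \<in> G1" if x: "x > 0" "x' > 0" for x x'
    proof -
      obtain t where t: "t \<ge> 0" "p + t *\<^sub>R (x *\<^sub>R d + x' *\<^sub>R e) \<in> G"
        using hit[OF c, of "x *\<^sub>R d + x' *\<^sub>R e"] x X0 X0' by auto
      have "p + (t * x) *\<^sub>R d + (t * x') *\<^sub>R e \<notin> G2" using G2 t x by simp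
      then show ?thesis using t by (auto simp: scaleR_add_right add.assoc)
    qed
    have nd: "n \<bullet> d > 0"
      by (rule limit_direction_positive[OF R m nG nrm]) (use hits[of 1] in auto)
    have ne: "n \<bullet> e > 0"
      by (rule limit_direction_positive[OF R m nG nrm(2,1)]) (use hits[of _ 1] in \<open>auto simp: add.commute\<close>)
    have ae: "a \<bullet> e \<noteq> 0" by (rule inner_det2_zero[OF ab(1,3) X0])
    have bd: "b \<bullet> d \<noteq> 0" by (rule inner_det2_zero[OF ab(2,4) X0'])
    have down: False if "norm y < r" "a \<bullet> y > 0" "b \<bullet> y > 0" "n \<bullet> y < 0" for y
    proof -
      have "p + y \<in> Z" using that by (intro inZ) (auto simp: dist_norm)
      then show False using pmin[of "p + y"] that by (simp add: inner_add_right)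
    qed
    consider "b \<bullet> d < 0" | "a \<bullet> e < 0" | "a \<bullet> e > 0" "b \<bullet> d > 0" using ae bd by linarith
    then show False
    proof cases
      case 1
      then show False using descent_direction[OF nd ne nrm ab(3,4) ae _ r(1)] down by metis
    next
      case 2
      then show False using descent_direction[OF ne nd nrm(2,1) ab(4,3) bd _ r(1)] down by metis
    next
      case 3
      define k where "k = r / 4"
      have k: "k > 0" using r by (simp add: k_def)
      have "norm (k *\<^sub>R d + k *\<^sub>R e) \<le> norm (k *\<^sub>R d) + norm (k *\<^sub>R e)" by (rule norm_triangle_ineq)
      also have "\<dots> < r" using nrm r by (simp add: k_def)
      finally have zb: "p + k *\<^sub>R d + k *\<^sub>R e \<in> ball p r"
        by (simp only: mem_ball dist_norm norm_minus_commute[of p] add.assoc add_diff_cancel_left')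
      have zZ: "p + k *\<^sub>R d + k *\<^sub>R e \<in> Z"
        using 3 k ab by (intro inZ[OF zb]) (auto simp: inner_add_right)
      have "closed_segment p (p + k *\<^sub>R d + k *\<^sub>R e) \<subseteq> ball p r" using zb r by (simp add: closed_segment_subset)
      then have seg: "closed_segment p (p + k *\<^sub>R d + k *\<^sub>R e) \<inter> G = {}" using r(2) W(2) by blast
      have sw: "p + x *\<^sub>R e + x' *\<^sub>R d = p + x' *\<^sub>R d + x *\<^sub>R e" for x x' by simp
      show False
      proof (cases "det2 e d > 0")
        case True
        show False
          by (rule not_trapped_in_sector[OF conn opn W cl True av only _ _ zZ k k seg])
            (use G1 G2 in blast)+
      next
        case False
        then have X: "det2 d e > 0" using X0 det2_commute[of d e] by simp
        have zZ': "p + k *\<^sub>R e + k *\<^sub>R d \<in> Z" and seg': "closed_segment p (p + k *\<^sub>R e + k *\<^sub>R d) \<inter> G = {}"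
          using zZ seg unfolding sw by auto
        show False
        proof (rule not_trapped_in_sector[OF conn opn W cl X av(2,1) _ _ _ zZ' k k seg'])
          show "\<exists>c>0. v = c *\<^sub>R e \<or> v = c *\<^sub>R d" if "v \<noteq> 0" "avoids G p v" for v using only[OF that] by blast
          show "\<exists>a>0. \<exists>b>0. y = p + a *\<^sub>R e + b *\<^sub>R d" if "y \<in> G1" for y using G1 that unfolding sw by blast
          show "p + a *\<^sub>R e + b *\<^sub>R d \<notin> G2" if "a \<ge> 0" "b \<ge> 0" for a b using G2 that unfolding sw by blast
        qed
      qed
    qed
  qed
qed

end

text \<open>On a sector the sum of the two coordinates is a linear functional that dominates the distance from the apex.\<close>
lemma hull_of_sector_misses_apex:
  assumes X: "det2 d e \<noteq> 0" and nrm: "norm d = 1" "norm e = 1"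
    and S: "\<forall>y\<in>S. \<exists>x>0. \<exists>x'>0. y = p + x *\<^sub>R d + x' *\<^sub>R e" and r: "r > 0" "ball p r \<inter> S = {}"
  shows "p \<notin> closure (convex hull S)"
proof -
  define \<nu> where "\<nu> = (1 / det2 d e) *\<^sub>R (\<i> * (d - e))"
  have nu: "\<nu> \<bullet> v = (det2 d v - det2 e v) / det2 d e" for v
    by (simp add: \<nu>_def det2_inner right_diff_distrib inner_diff_left diff_divide_distrib)
  have "S \<subseteq> {y. \<nu> \<bullet> y \<ge> \<nu> \<bullet> p + r}"
  proof
    fix y assume y: "y \<in> S"
    then obtain x x' where x: "x > 0" "x' > 0" "y = p + x *\<^sub>R d + x' *\<^sub>R e" using S by blast
    have "y \<notin> ball p r" using y r by blast
    then have "r \<le> norm (y - p)" by (simp add: dist_norm norm_minus_commute)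
    also have "y - p = x *\<^sub>R d + x' *\<^sub>R e" using x(3) by simp
    also have "norm (x *\<^sub>R d + x' *\<^sub>R e) \<le> x + x'" using norm_triangle_ineq[of "x *\<^sub>R d" "x' *\<^sub>R e"] x nrm by simp
    also have "x + x' = \<nu> \<bullet> (x *\<^sub>R d + x' *\<^sub>R e)"
      unfolding nu using X det2_commute[of e d] by (simp add: field_simps)
    finally show "y \<in> {y. \<nu> \<bullet> y \<ge> \<nu> \<bullet> p + r}" using x(3) by (simp add: inner_add_right)
  qed
  then have "closure (convex hull S) \<subseteq> {y. \<nu> \<bullet> y \<ge> \<nu> \<bullet> p + r}"
    by (intro closure_minimal hull_minimal convex_halfspace_ge closed_halfspace_ge)
  then show ?thesis using r by auto
qed

context two_obstacles begin

text \<open>The trapped set lies in both closed hulls, and so does an extreme point \<open>p\<close> of its hull.  If the two free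
directions at \<open>p\<close> are not opposite, the obstacle in the convex sector has a hull that misses \<open>p\<close>.  If they are
opposite, the hulls lie on the two sides of a line, and the open trapped set would be contained in that line.\<close>
lemma contradiction: False
proof -
  interpret swap: two_obstacles G2 G1 W
    using opn conn nonempty bdd W cl some_trapped by unfold_locales (auto simp: Un_commute)
  have sub: "Z \<subseteq> closure (convex hull G1)" "Z \<subseteq> closure (convex hull G2)"
    using Z_subset_hull swap.Z_subset_hull by (auto simp: Un_commute)
  have "convex hull (closure Z) \<noteq> {}" using some_trapped by simp
  then obtain p where p: "p extreme_point_of (convex hull (closure Z))"
    using extreme_point_exists_convex[OF compact_hull convex_convex_hull] by blast
  note pos = extreme_point_position[OF p]
  obtain d e a b r where c: "corner p d e a b r" using extreme_point_corner[OF p] .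
  then have nrm: "norm d = 1" "norm e = 1" and r: "r > 0" "ball p r \<subseteq> W" by (auto simp: corner_def)
  have rG: "ball p r \<inter> G1 = {}" "ball p r \<inter> G2 = {}" using r W by auto
  have pC: "p \<in> closure (convex hull G1)" "p \<in> closure (convex hull G2)"
    using pos(1) closure_minimal[OF sub(1)] closure_minimal[OF sub(2)] by auto
  show False
  proof (cases "det2 d e = 0")
    case False
    then show False using sector_split[OF c False] pC
        hull_of_sector_misses_apex[OF False nrm _ r(1) rG(1)] hull_of_sector_misses_apex[OF False nrm _ r(1) rG(2)]
      by blast
  next
    case True
    obtain s where s: "e = - d" "s \<noteq> 0" and G1: "\<And>y. y \<in> G1 \<Longrightarrow> s * det2 d (y - p) > 0"
      and G2: "\<And>y. y \<in> G2 \<Longrightarrow> s * det2 d (y - p) < 0" using opposite_split[OF c True] by blast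
    define \<nu> where "\<nu> = s *\<^sub>R (\<i> * d)"
    have nu: "s * det2 d (y - p) = \<nu> \<bullet> y - \<nu> \<bullet> p" for y
      by (simp add: \<nu>_def det2_inner inner_diff_right right_diff_distrib)
    have "closure (convex hull G1) \<subseteq> {y. \<nu> \<bullet> y \<ge> \<nu> \<bullet> p}"
      by (intro closure_minimal hull_minimal convex_halfspace_ge closed_halfspace_ge) (use G1 nu in force)
    moreover have "closure (convex hull G2) \<subseteq> {y. \<nu> \<bullet> y \<le> \<nu> \<bullet> p}"
      by (intro closure_minimal hull_minimal convex_halfspace_le closed_halfspace_le) (use G2 nu in force)
    ultimately have "\<nu> \<bullet> z = \<nu> \<bullet> p" if "z \<in> Z" for z using sub that by force
    then have "det2 d (z - p) = 0" if "z \<in> Z" for z using nu[of z] s(2) that by simp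
    moreover have "d \<noteq> 0" using nrm by auto
    ultimately show False using open_point_off_line[OF open_Z some_trapped] by metis
  qed
qed

end

section \<open>From weakly semiconvex sets to obstacles\<close>

lemma connect_points_compactly:
  fixes U :: "complex set"
  assumes U: "open U" "connected U" and b: "b \<in> U" "y \<in> U"
  shows "\<exists>S. open S \<and> connected S \<and> bounded S \<and> closure S \<subseteq> U \<and> b \<in> S \<and> y \<in> S"
proof -
  have "path_connected U" using U by (simp add: connected_open_path_connected)
  then obtain g where g: "path g" "path_image g \<subseteq> U" "pathstart g = b" "pathfinish g = y"
    using b unfolding path_connected_def by blast
  define P where "P = path_image g"
  have P: "compact P" "connected P" "P \<subseteq> U" "b \<in> P" "y \<in> P"
    using g compact_path_image connected_path_image by (auto simp: P_def)
  obtain \<epsilon> where \<epsilon>: "\<epsilon> > 0" "(\<Union>x\<in>P. cball x \<epsilon>) \<subseteq> U"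
    using compact_subset_open_imp_cball_epsilon_subset[OF P(1) U(1) P(3)] by blast
  define S where "S = (\<Union>x\<in>P. \<Union>e\<in>ball 0 \<epsilon>. {x + e})"
  define T where "T = (\<Union>x\<in>P. \<Union>e\<in>cball 0 \<epsilon>. {x + e})"
  have "compact T" unfolding T_def by (intro compact_sums' P(1) compact_cball)
  have "S \<subseteq> T" unfolding S_def T_def by force
  have "T \<subseteq> U"
  proof
    fix u assume "u \<in> T"
    then obtain x e where "x \<in> P" "norm e \<le> \<epsilon>" "u = x + e" by (auto simp: T_def)
    then have "u \<in> cball x \<epsilon>" by (simp add: dist_norm)
    then show "u \<in> U" using \<epsilon>(2) \<open>x \<in> P\<close> by blast
  qed
  have S: "open S" unfolding S_def by (intro open_sums) simp
  moreover have "connected S"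
  proof -
    have "S = (\<lambda>z. fst z + snd z) ` (P \<times> ball 0 \<epsilon>)" unfolding S_def by force
    moreover have "connected \<dots>"
      by (intro connected_continuous_image continuous_intros connected_Times P(2)) simp
    ultimately show ?thesis by simp
  qed
  moreover have "bounded S"
    using \<open>compact T\<close> \<open>S \<subseteq> T\<close> compact_imp_bounded bounded_subset by blast
  moreover have "closure S \<subseteq> U"
    using closure_minimal[OF \<open>S \<subseteq> T\<close> compact_imp_closed[OF \<open>compact T\<close>]] \<open>T \<subseteq> U\<close> by blast
  moreover have "x \<in> S" if "x \<in> P" for x
    unfolding S_def using that \<epsilon>(1) by (intro UN_I[of x] UN_I[of 0]) auto
  ultimately show ?thesis using P(4,5) by (intro exI[of _ S]) blast
qed

text \<open>By compactness of the circle of directions, finitely many bounded open pieces of \<open>U\<close> suffice to block \<open>x\<close>.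
Each piece is chosen to contain a base point of \<open>C1\<close> or of \<open>C2\<close>, so that their unions stay connected.\<close>
lemma blocking_neighbourhoods:
  fixes U :: "complex set"
  assumes U: "open U" and C: "connected C1" "connected C2" "C1 \<noteq> {}" "C2 \<noteq> {}" "C1 \<subseteq> U" "C2 \<subseteq> U"
    and blocked: "\<And>v. v \<noteq> 0 \<Longrightarrow> \<not> avoids (C1 \<union> C2) x v"
  obtains G1 G2 where "open G1" "open G2" "connected G1" "connected G2" "G1 \<noteq> {}" "G2 \<noteq> {}"
    "bounded G1" "bounded G2" "closure G1 \<subseteq> U" "closure G2 \<subseteq> U"
    "\<And>v. v \<noteq> 0 \<Longrightarrow> \<not> avoids (G1 \<union> G2) x v"
proof -
  define M where "M b = {S. open S \<and> connected S \<and> bounded S \<and> closure S \<subseteq> U \<and> b \<in> S}" for b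
  have reach: "\<exists>S\<in>M b. y \<in> S" if "connected D" "D \<subseteq> U" "b \<in> D" "y \<in> D" for b y D
  proof -
    define V where "V = connected_component_set U b"
    have V: "open V" "connected V" "V \<subseteq> U" unfolding V_def
      using U by (auto simp: open_connected_component connected_component_subset)
    have "D \<subseteq> V" unfolding V_def using that by (intro connected_component_maximal) auto
    then have "b \<in> V" "y \<in> V" using that by auto
    from connect_points_compactly[OF V(1,2) this] obtain S where
      "open S \<and> connected S \<and> bounded S \<and> closure S \<subseteq> V \<and> b \<in> S \<and> y \<in> S" ..
    then have "S \<in> M b" "y \<in> S" using V(3) by (auto simp: M_def)
    then show ?thesis ..
  qed
  obtain b1 b2 where b: "b1 \<in> C1" "b2 \<in> C2" using C by blast
  define f where "f S = {v. \<exists>t\<ge>0. x + t *\<^sub>R v \<in> S}" for S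
  have of: "open (f S)" if "open S" for S
  proof -
    have "f S = (\<Union>t\<in>{0..}. (\<lambda>v. x + t *\<^sub>R v) -` S)" by (auto simp: f_def)
    moreover have "open \<dots>" by (intro open_UN ballI open_vimage that continuous_intros)
    ultimately show ?thesis by simp
  qed
  have cover: "sphere 0 1 \<subseteq> (\<Union>S\<in>M b1 \<union> M b2. f S)"
  proof
    fix v :: complex assume "v \<in> sphere 0 1"
    then have "v \<noteq> 0" by auto
    then obtain t where t: "t \<ge> 0" "x + t *\<^sub>R v \<in> C1 \<union> C2" using blocked by (auto simp: avoids_def)
    then obtain S where "S \<in> M b1 \<union> M b2" "x + t *\<^sub>R v \<in> S"
      using reach[OF C(1,5) b(1)] reach[OF C(2,6) b(2)] by blast
    then show "v \<in> (\<Union>S\<in>M b1 \<union> M b2. f S)" using t by (auto simp: f_def)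
  qed
  have "compact (sphere (0::complex) 1)" by simp
  moreover have "\<And>S. S \<in> M b1 \<union> M b2 \<Longrightarrow> open (f S)" by (intro of) (auto simp: M_def)
  ultimately obtain D where D: "D \<subseteq> M b1 \<union> M b2" "finite D" "sphere 0 1 \<subseteq> (\<Union>S\<in>D. f S)"
    using compactE_image[OF _ _ cover] by metis
  have union: "\<Union>F \<in> M b" if F: "finite F" "F \<noteq> {}" "F \<subseteq> M b" for F b
  proof -
    have "connected (\<Union>F)" using F by (intro connected_Union) (auto simp: M_def)
    moreover have "closure (\<Union>F) \<subseteq> (\<Union>S\<in>F. closure S)"
      by (rule closure_minimal) (use F(1) closure_subset in \<open>auto intro!: closed_UN\<close>)
    then have "closure (\<Union>F) \<subseteq> U" using F(3) by (auto simp: M_def)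
    moreover have "open (\<Union>F)" "bounded (\<Union>F)" "b \<in> \<Union>F" using F by (auto simp: M_def)
    ultimately show ?thesis by (simp add: M_def)
  qed
  obtain S1 where S1: "S1 \<in> M b1" using reach[OF C(1,5) b(1) b(1)] by blast
  obtain S2 where S2: "S2 \<in> M b2" using reach[OF C(2,6) b(2) b(2)] by blast
  define G1 where "G1 = \<Union>(insert S1 (D \<inter> M b1))"
  define G2 where "G2 = \<Union>(insert S2 (D \<inter> M b2))"
  have G: "G1 \<in> M b1" "G2 \<in> M b2" unfolding G1_def G2_def
    by (rule union; use D(2) S1 S2 in auto)+
  have "\<not> avoids (G1 \<union> G2) x v" if v: "v \<noteq> 0" for v
  proof
    assume "avoids (G1 \<union> G2) x v"
    then have av: "avoids (G1 \<union> G2) x ((1 / norm v) *\<^sub>R v)" by (rule avoids_scale) simp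
    have "(1 / norm v) *\<^sub>R v \<in> sphere 0 1" using v by simp
    then obtain S where S: "S \<in> D" "(1 / norm v) *\<^sub>R v \<in> f S" using D(3) by blast
    then have "S \<subseteq> G1 \<union> G2" using D(1) by (auto simp: G1_def G2_def)
    then show False using S(2) av unfolding f_def avoids_def by blast
  qed
  then show thesis using G that[of G1 G2] by (auto simp: M_def)
qed

lemma closed_ray:
  fixes p v :: complex
  shows "closed {p + t *\<^sub>R v | t. t \<ge> 0}"
proof (cases "v = 0")
  case True
  then have "{p + t *\<^sub>R v | t. t \<ge> 0} = {p}" by auto
  then show ?thesis by simp
next
  case False
  have "closed ((\<lambda>t. t *\<^sub>R v) ` {0..})"
    by (intro closed_injective_linear_image linear_scale_left injI) (use False in auto)
  then have "closed ((+) p ` ((\<lambda>t. t *\<^sub>R v) ` {0..}))" by (rule closed_translation)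
  moreover have "(+) p ` ((\<lambda>t. t *\<^sub>R v) ` {0..}) = {p + t *\<^sub>R v | t. t \<ge> 0}" by auto
  ultimately show ?thesis by simp
qed

text \<open>The obstacles are bounded neighbourhoods with closure in \<open>U\<close>, and \<open>W\<close> is the exterior of \<open>U\<close>.  A point of
the frontier of \<open>U\<close> has a ray outside \<open>U\<close>, hence at positive distance from the compact closure of the
obstacles; parallel rays from nearby points are free as well, so trapped points cannot accumulate there.\<close>
lemma two_connected_sets_do_not_block:
  fixes U :: "complex set"
  assumes U: "open U" "\<And>p. p \<in> frontier U \<Longrightarrow> \<exists>v. v \<noteq> 0 \<and> avoids U p v"
    and C: "connected C1" "connected C2" "C1 \<noteq> {}" "C2 \<noteq> {}" "C1 \<subseteq> U" "C2 \<subseteq> U" and x: "x \<notin> U"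
  shows "\<exists>v. v \<noteq> 0 \<and> avoids (C1 \<union> C2) x v"
proof (rule ccontr)
  assume "\<not> ?thesis"
  then have blocked: "\<not> avoids (C1 \<union> C2) x v" if "v \<noteq> 0" for v using that by blast
  obtain G1 G2 where G: "open G1" "open G2" "connected G1" "connected G2" "G1 \<noteq> {}" "G2 \<noteq> {}"
    "bounded G1" "bounded G2" "closure G1 \<subseteq> U" "closure G2 \<subseteq> U"
    and tr: "\<And>v. v \<noteq> 0 \<Longrightarrow> \<not> avoids (G1 \<union> G2) x v"
    using blocking_neighbourhoods[OF U(1) C blocked] by metis
  define G where "G = G1 \<union> G2"
  define W where "W = - closure U"
  have cG: "compact (closure G)" "closure G \<subseteq> U" "G \<subseteq> closure G"
    using G closure_subset by (auto simp: G_def closure_Un)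
  have WU: "W \<inter> U = {}" using closure_subset[of U] by (auto simp: W_def)
  have front: "p \<in> frontier U" if "p \<in> closure U" "p \<notin> U" for p
    using that U(1) by (simp add: frontier_def interior_open)
  have "x \<in> trapped G W"
  proof -
    have "x \<notin> frontier U"
    proof
      assume "x \<in> frontier U"
      then obtain v where v: "v \<noteq> 0" "avoids U x v" using U(2) by blast
      have "C1 \<union> C2 \<subseteq> U" using C by blast
      then have "avoids (C1 \<union> C2) x v" using v(2) unfolding avoids_def by blast
      then show False using blocked v(1) by blast
    qed
    then show ?thesis using front x tr by (auto simp: W_def trapped_def G_def)
  qed
  moreover have "closure (trapped G W) \<subseteq> W"
  proof
    fix p assume p: "p \<in> closure (trapped G W)"
    have "trapped G W \<inter> U = {}" using WU by (auto simp: trapped_def)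
    then have pU: "p \<notin> U" using p U(1) by (metis disjoint_iff open_Int_closure_eq_empty inf_commute)
    show "p \<in> W"
    proof (rule ccontr)
      assume "p \<notin> W"
      then have "p \<in> frontier U" using front pU by (simp add: W_def)
      then obtain v where v: "v \<noteq> 0" "avoids U p v" using U(2) by blast
      define R where "R = {p + t *\<^sub>R v | t. t \<ge> 0}"
      have "closure G \<inter> R = {}" using v(2) cG(2) by (auto simp: R_def avoids_def)
      then obtain \<delta> where d: "\<delta> > 0" "\<And>y q. y \<in> closure G \<Longrightarrow> q \<in> R \<Longrightarrow> \<delta> \<le> dist y q"
        using separate_compact_closed[OF cG(1) closed_ray[of p v, folded R_def]] by blast
      obtain z where z: "z \<in> trapped G W" "dist z p < \<delta>"
        using p d(1) by (auto simp: closure_approachable)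
      then obtain t where t: "t \<ge> 0" "z + t *\<^sub>R v \<in> G" using trappedD[OF z(1) v(1)] by blast
      have "\<delta> \<le> dist (z + t *\<^sub>R v) (p + t *\<^sub>R v)"
        using t cG(3) by (intro d(2)) (auto simp: R_def)
      then show False using z(2) by simp
    qed
  qed
  moreover have "W \<inter> G = {}" using WU cG by blast
  moreover have "open W" by (simp add: W_def open_Compl)
  ultimately have "two_obstacles G1 G2 W"
    unfolding two_obstacles_def using G by (auto simp: G_def)
  then show False by (rule two_obstacles.contradiction)
qed

lemma semiconvex1_wrtI:
  assumes "d \<noteq> 0" "\<And>t. t \<ge> 0 \<Longrightarrow> x + t *\<^sub>R d \<notin> S"
  shows "semiconvex1_wrt S x"
proof -
  let ?L = "{x + t *\<^sub>R d | t. t \<ge> 0}"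
  have "is_ray ?L" unfolding is_ray_def using assms(1) by blast
  moreover have "x + 0 *\<^sub>R d \<in> ?L" by blast
  then have "x \<in> ?L" by (simp only: scaleR_zero_left add_0_right)
  moreover have "?L \<inter> S = {}" using assms(2) by blast
  ultimately show ?thesis unfolding semiconvex1_wrt_def by blast
qed

definition complex_of_vec :: "real^2 \<Rightarrow> complex" where
  "complex_of_vec x = Complex (x $ 1) (x $ 2)"

lemma linear_complex_of_vec: "linear complex_of_vec"
  by (rule linearI) (auto simp: complex_of_vec_def complex_eq_iff)

lemma bij_complex_of_vec: "bij complex_of_vec"
proof (rule bijI)
  show "inj complex_of_vec"
    by (rule injI) (auto simp: complex_of_vec_def vec_eq_iff forall_2)
  show "surj complex_of_vec"
  proof (rule surjI)
    fix z show "complex_of_vec (vector [Re z, Im z]) = z" by (simp add: complex_of_vec_def)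
  qed
qed

text \<open>Rays, openness and frontiers are preserved by the linear isomorphism with the complex plane.\<close>
lemma weakly_semiconvex_open_two_parts:
  assumes U: "weakly_semiconvex1_open U"
    and C: "connected C1" "connected C2" "C1 \<noteq> {}" "C2 \<noteq> {}" "C1 \<subseteq> U" "C2 \<subseteq> U" and x: "x \<notin> U"
  shows "semiconvex1_wrt (C1 \<union> C2) x"
proof -
  let ?f = complex_of_vec
  note lin = linear_complex_of_vec and bij = bij_complex_of_vec
  have inj: "inj ?f" and surj: "surj ?f" using bij by (auto simp: bij_def)
  have move: "?f (p + t *\<^sub>R d) = ?f p + t *\<^sub>R ?f d" for p d t
    by (simp add: linear_add[OF lin] linear_scale[OF lin])
  have f0: "?f d = 0 \<longleftrightarrow> d = 0" for d using inj lin by (simp add: linear_injective_0 linear_0 inj_eq)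
      (metis injD linear_0)
  have avoids_image: "avoids (?f ` S) (?f p) (?f d) \<longleftrightarrow> (\<forall>t\<ge>0. p + t *\<^sub>R d \<notin> S)" for S p d
    unfolding avoids_def move[symmetric] using inj by (auto simp: inj_image_mem_iff)
  have "open (?f ` U)" using U open_bijective_linear_image_eq[OF lin bij] by (simp add: weakly_semiconvex1_open_def)
  moreover have "\<exists>v. v \<noteq> 0 \<and> avoids (?f ` U) p v" if "p \<in> frontier (?f ` U)" for p
  proof -
    have "frontier (?f ` U) = ?f ` frontier U"
      unfolding frontier_def using inj
      by (simp add: closure_injective_linear_image[OF lin] interior_bijective_linear_image[OF lin bij] image_set_diff)
    then have "p \<in> ?f ` frontier U" using that by simp
    then obtain q where q: "p = ?f q" "q \<in> frontier U" by (rule imageE)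
    then have "semiconvex1_wrt U q" using U by (simp add: weakly_semiconvex1_open_def)
    then obtain L where L: "is_ray L" "q \<in> L" "L \<inter> U = {}" unfolding semiconvex1_wrt_def by blast
    from L(1) obtain a d where ad: "d \<noteq> 0 \<and> L = {a + t *\<^sub>R d | t. t \<ge> 0}"
      unfolding is_ray_def by (elim exE) (rule that)
    then have mem: "y \<in> L \<longleftrightarrow> (\<exists>t\<ge>0. y = a + t *\<^sub>R d)" for y by auto
    then obtain s where s: "s \<ge> 0" "q = a + s *\<^sub>R d" using L(2) by blast
    have "q + t *\<^sub>R d \<notin> U" if "t \<ge> 0" for t
    proof -
      have "q + t *\<^sub>R d = a + (s + t) *\<^sub>R d" using s by (simp add: algebra_simps)
      then have "q + t *\<^sub>R d \<in> L" unfolding mem using s(1) that by (intro exI[of _ "s + t"]) simp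
      then show ?thesis using L(3) by blast
    qed
    then have "avoids (?f ` U) p (?f d)" unfolding q(1) avoids_image by blast
    then show ?thesis using ad f0 by blast
  qed
  moreover have "connected (?f ` C1)" "connected (?f ` C2)"
    using C lin by (auto intro!: connected_continuous_image linear_continuous_on simp: linear_conv_bounded_linear)
  moreover have "?f ` C1 \<noteq> {}" "?f ` C2 \<noteq> {}" "?f ` C1 \<subseteq> ?f ` U" "?f ` C2 \<subseteq> ?f ` U" using C by auto
  moreover have "?f x \<notin> ?f ` U" using x inj by (simp add: inj_image_mem_iff)
  ultimately have "\<exists>v. v \<noteq> 0 \<and> avoids (?f ` C1 \<union> ?f ` C2) (?f x) v"
    by (rule two_connected_sets_do_not_block)
  then obtain v where v: "v \<noteq> 0" "avoids (?f ` C1 \<union> ?f ` C2) (?f x) v" by blast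
  obtain d where d: "v = ?f d" using surj by (metis surj_def)
  have "d \<noteq> 0" using v(1) d f0 by blast
  moreover have "\<forall>t\<ge>0. x + t *\<^sub>R d \<notin> C1 \<union> C2"
    using v(2) unfolding d image_Un[symmetric] avoids_image .
  ultimately show ?thesis by (intro semiconvex1_wrtI[of d]) auto
qed

theorem theorem5:
  fixes E :: "(real^2) set"
  assumes "closed E"
    and "weakly_semiconvex1_closed E"
    and "\<not> semiconvex1 E"
  shows "infinite (components E) \<or> card (components E) \<ge> 3"
proof (rule ccontr)
  assume "\<not> ?thesis"
  then have fin: "finite (components E)" "card (components E) < 3" by auto
  obtain x where x: "x \<notin> E" "\<not> semiconvex1_wrt E x" using assms(3) by (auto simp: semiconvex1_def)
  have "E \<noteq> {}" using x(2) semiconvex1_wrtI[of 1 x "{}"] by auto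
  then have "components E \<noteq> {}" by (simp add: components_eq_empty)
  then have "card (components E) \<noteq> 0" using fin by simp
  then have "card (components E) = 1 \<or> card (components E) = 2" using fin(2) by linarith
  \<comment> \<open>If \<open>E\<close> is connected, both are \<open>E\<close> itself; the obstacles may overlap.\<close>
  then obtain C1 C2 where "components E = {C1, C2}"
    by (metis card_1_singletonE card_2_iff insert_absorb2)
  then have C: "C1 \<in> components E" "C2 \<in> components E" "E = C1 \<union> C2"
    using Union_components[of E] by auto
  obtain A :: "nat \<Rightarrow> (real^2) set" where A: "E = (\<Inter>k. A k)" "\<And>k. weakly_semiconvex1_open (A k)"
    using assms(2) unfolding weakly_semiconvex1_closed_def approximated_from_outside_def by blast
  obtain k where k: "x \<notin> A k" using x(1) A(1) by blast
  have "connected C1" "connected C2" "C1 \<noteq> {}" "C2 \<noteq> {}"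
    using C(1,2) in_components_connected in_components_nonempty by blast+
  moreover have "C1 \<subseteq> A k" "C2 \<subseteq> A k" using A(1) C(3) by blast+
  ultimately have "semiconvex1_wrt (C1 \<union> C2) x"
    by (rule weakly_semiconvex_open_two_parts[OF A(2) _ _ _ _ _ _ k])
  then show False using x(2) C(3) by simp
qed

end
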